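(* Let $n\in\mathbb{N}^{\ast}$ and $X=K^{n}$. Let $M\geq 1$, $\omega_1,\dots,\omega_M\in Lip(T)$ with Lipschitz constants $r_i=\|\omega_i\|_L$, and $R_1,\dots,R_M\in\mathcal{L}(K^n)$; let $H:cabv(K^n)\to cabv(K^n)$ be given by $H(\mu)=\sum_{i=1}^{M}R_i\circ\omega_i(\mu)$. Assume: (a) $d=\sum_{i=1}^{M}\|R_i\|_o(1+r_i)<1$ (this is true, in particular, if all $\omega_i$ are contractions and $\sum_{i=1}^{M}\|R_i\|_o\leq\frac12$); (b) $0<a<\infty$, $\mu^0\in cabv(K^n)$, $\emptyset\neq A\subseteq B_a(K^n)$ is weak$^{\ast}$ closed and $H(\mu)+\mu^0\in A$ for any $\mu\in A$. (In particular, if $\|\mu^0\|+a\sum_{i=1}^{M}\|R_i\|_o\leq a$, then one can take $A=B_a(K^n)$.) Under these hypotheses, define $H_2:A\to A$ via $H_2(\mu)=H(\mu)+\mu^0$ for any $\mu\in A$. Then $H_2$ is a contraction with contraction factor $\leq d$ if $A$ is equipped with the metric $d_{MK}(\mu,\nu)=\|\mu-\nu\|_{MK}$. Moreover: (i) if $\mu^0=0$, then $0\in A$; (ii) there exists a unique $\mu^{\ast}\in A$ such that $H_2(\mu^{\ast})=\mu^{\ast}$; in case $\mu^0=0$, we have $\mu^{\ast}=0$.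
   Context: $K$ is $\mathbb{R}$ or $\mathbb{C}$; $K^n$ carries the standard scalar product $\langle x,y\rangle=\sum_i x_i\overline{y_i}$ and the Euclidean norm. $(T,\rho)$ is a compact metric space (metric denoted $\rho$ here) with at least two elements, $\mathcal{B}$ its Borel $\sigma$-algebra. $\mathbb{N}^{\ast}=\{1,2,\dots\}$. For a map $f$ from $T$ to a metric space $(Y,\sigma)$, $\|f\|_L=\sup\{\sigma(f(x),f(y))/\rho(x,y): x\neq y\}$; $Lip(T,Y)$ is the set of $f$ with $\|f\|_L<\infty$, $Lip(T)=Lip(T,T)$; a contraction is a Lipschitz self-map with $\|f\|_L<1$, and $\|f\|_L$ is its contraction factor. $\mathcal{L}(X)$ is the space of continuous linear operators on $X$, with operator norm $\|\cdot\|_o$. $cabv(X)$ is the space of $\sigma$-additive $\mu:\mathcal{B}\to X$ with finite total variation $\|\mu\|=|\mu|(T)=\sup\sum_i\|\mu(A_i)\|$ (supremum over finite Borel partitions $(A_i)$ of $T$); this is the variational norm. For continuous $h:T\to T$, $h(\mu)(B)=\mu(h^{-1}(B))$ for $B\in\mathcal{B}$; for $R\in\mathcal{L}(X)$, $(R\circ h(\mu))(B)=R(\mu(h^{-1}(B)))$. $B_a(X)=\{\mu\in cabv(X):\|\mu\|\leq a\}$. Integral: for a simple function $f=\sum_i\varphi_{A_i}x_i$ ($(A_i)$ a finite Borel partition of $T$, $x_i\in X$, $\varphi_A$ the indicator function of $A$), $\int f\,d\mu=\sum_i\langle x_i,\mu(A_i)\rangle$; for $f$ a uniform limit of simple functions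 $f_m$ (in particular for $f\in C(T,X)$, the continuous functions), $\int f\,d\mu=\lim_m\int f_m\,d\mu$. With $\|f\|_\infty$ the sup norm and $\|f\|_{BL}=\|f\|_\infty+\|f\|_L$ on $Lip(T,X)$, the Monge-Kantorovich norm on $cabv(X)$ is $\|\mu\|_{MK}=\sup\{|\int f\,d\mu|: f\in Lip(T,X),\ \|f\|_{BL}\leq 1\}$. The weak$^{\ast}$ topology on $cabv(K^n)$ is the one obtained from the identification $cabv(X)\equiv C(T,X)'$, $\mu\mapsto(f\mapsto\int f\,d\mu)$, i.e. the coarsest topology making all maps $\mu\mapsto\int f\,d\mu$, $f\in C(T,X)$, continuous. *)

theory Defs
  imports "HOL-Analysis.Analysis" "HOL-Library.Function_Algebras"
begin

text \<open>
  The scalar field \<open>K\<close>, which is either the reals or the complex numbers. A real normed field is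
  isometrically isomorphic to one of these two (Gelfand-Mazur), and \<open>mult_scnj\<close> leaves the usual
  conjugation as the only possible \<open>scnj\<close>. So, up to isomorphism, the two instances below are
  the only ones. The Euclidean space structure adds nothing beyond the norm; it makes the library
  norm on \<open>'k ^ 'n\<close> available as a Euclidean one.
\<close>

class real_or_complex = real_normed_field + euclidean_space +
  fixes scnj :: "'a \<Rightarrow> 'a"
  assumes scnj_add: "scnj (x + y) = scnj x + scnj y"
    and scnj_mult: "scnj (x * y) = scnj x * scnj y"
    and scnj_scnj: "scnj (scnj x) = x"
    and mult_scnj: "x * scnj x = (norm x)\<^sup>2 *\<^sub>R 1"

instantiation real :: real_or_complex
begin

definition scnj_real :: "real \<Rightarrow> real" where "scnj_real x = x"

instance
  by standard (auto simp: scnj_real_def power2_eq_square)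

end

instantiation complex :: real_or_complex
begin

definition scnj_complex :: "complex \<Rightarrow> complex" where "scnj_complex = cnj"

instance
  by standard (auto simp: scnj_complex_def complex_norm_square scaleR_conv_of_real simp flip: of_real_power)

end

definition sprod :: "'k::real_or_complex ^ 'n \<Rightarrow> 'k ^ 'n \<Rightarrow> 'k" where
  "sprod x y = (\<Sum>i\<in>UNIV. x $ i * scnj (y $ i))"

definition cont_lin_ops :: "('k::real_or_complex ^ 'n \<Rightarrow> 'k ^ 'n) set" where
  "cont_lin_ops = {R. Vector_Spaces.linear (*s) (*s) R \<and> continuous_on UNIV R}"

text \<open>
  The Lipschitz constant of a map from \<open>S\<close> with metric \<open>\<rho>\<close> to a space with metric \<open>\<sigma>\<close>. On a
  singleton the supremum in \<^typ>\<open>ennreal\<close> is \<open>0\<close>.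
\<close>

definition lip_on :: "'a set \<Rightarrow> ('a \<Rightarrow> 'a \<Rightarrow> real) \<Rightarrow> ('b \<Rightarrow> 'b \<Rightarrow> real) \<Rightarrow> ('a \<Rightarrow> 'b) \<Rightarrow> ennreal" where
  "lip_on S \<rho> \<sigma> f =
     (SUP (x, y) \<in> {(x, y). x \<in> S \<and> y \<in> S \<and> x \<noteq> y}. ennreal (\<sigma> (f x) (f y) / \<rho> x y))"

definition contraction_on :: "'a set \<Rightarrow> ('a \<Rightarrow> 'a \<Rightarrow> real) \<Rightarrow> ('a \<Rightarrow> 'a) \<Rightarrow> bool" where
  "contraction_on S \<rho> f \<longleftrightarrow> f \<in> S \<rightarrow> S \<and> lip_on S \<rho> \<rho> f < 1"

abbreviation lip :: "('a::metric_space \<Rightarrow> 'b::metric_space) \<Rightarrow> ennreal" where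
  "lip \<equiv> lip_on UNIV dist dist"

definition Lip :: "('a::metric_space \<Rightarrow> 'b::metric_space) set" where
  "Lip = {f. lip f < \<infinity>}"

definition bl_norm :: "('a::metric_space \<Rightarrow> 'b::real_normed_vector) \<Rightarrow> ennreal" where
  "bl_norm f = (SUP x. ennreal (norm (f x))) + lip f"

text \<open>
  Vector measures are functions on all sets that take the value \<open>0\<close> outside the Borel
  \<open>\<sigma>\<close>-algebra, so that equality of functions is equality of measures.
\<close>

definition variation :: "('t::topological_space set \<Rightarrow> 'b::real_normed_vector) \<Rightarrow> ennreal" where
  "variation \<mu> =
     (SUP P \<in> {P. finite P \<and> partition_on UNIV P \<and> P \<subseteq> sets borel}. \<Sum>A\<in>P. ennreal (norm (\<mu> A)))"

definition cabv :: "('t::topological_space set \<Rightarrow> 'b::real_normed_vector) set" where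
  "cabv = {\<mu>. (\<forall>B. B \<notin> sets borel \<longrightarrow> \<mu> B = 0) \<and>
     (\<forall>A::nat \<Rightarrow> 't set. range A \<subseteq> sets borel \<longrightarrow> disjoint_family A \<longrightarrow>
        (\<lambda>i. \<mu> (A i)) sums \<mu> (\<Union>i. A i)) \<and>
     variation \<mu> < \<infinity>}"

definition cabv_ball :: "real \<Rightarrow> ('t::topological_space set \<Rightarrow> 'b::real_normed_vector) set" where
  "cabv_ball a = {\<mu> \<in> cabv. variation \<mu> \<le> ennreal a}"

text \<open>
  \<open>R \<circ> h(\<mu>)\<close>. The restriction to Borel sets is needed because \<open>h -` B\<close> may be Borel for a
  non-Borel \<open>B\<close>.
\<close>

definition op_image ::
  "('b \<Rightarrow> 'b) \<Rightarrow> ('t \<Rightarrow> 't) \<Rightarrow> ('t::topological_space set \<Rightarrow> 'b::real_normed_vector) \<Rightarrow> 't set \<Rightarrow> 'b" where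
  "op_image R h \<mu> = (\<lambda>B. if B \<in> sets borel then R (\<mu> (h -` B)) else 0)"

text \<open>
  The integral of a simple function is given through its coarsest representation
  \<open>f = (\<Sum>x\<in>range f. \<phi>\<^bsub>f -` {x}\<^esub> x)\<close>; by additivity of \<open>\<mu>\<close> any other one gives the same value.
\<close>

definition simple_vint :: "('t::topological_space set \<Rightarrow> 'k::real_or_complex ^ 'n) \<Rightarrow> ('t \<Rightarrow> 'k ^ 'n) \<Rightarrow> 'k" where
  "simple_vint \<mu> f = (\<Sum>x\<in>range f. sprod x (\<mu> (f -` {x})))"

text \<open>
  For \<open>\<mu> \<in> cabv\<close> and a uniform limit \<open>f\<close> of simple functions, the limit exists and is the same for
  all approximating sequences.
\<close>

definition vint :: "('t::topological_space set \<Rightarrow> 'k::real_or_complex ^ 'n) \<Rightarrow> ('t \<Rightarrow> 'k ^ 'n) \<Rightarrow> 'k" where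
  "vint \<mu> f = (THE I. \<exists>F. (\<forall>m. simple_function borel (F m)) \<and>
     uniform_limit UNIV F f sequentially \<and> (\<lambda>m. simple_vint \<mu> (F m)) \<longlonglongrightarrow> I)"

definition mk_norm :: "('t::metric_space set \<Rightarrow> 'k::real_or_complex ^ 'n) \<Rightarrow> real" where
  "mk_norm \<mu> = (SUP f \<in> {f \<in> Lip. bl_norm f \<le> 1}. norm (vint \<mu> f))"

text \<open>The locale \<^locale>\<open>Metric_space\<close> requires symmetry also for arguments outside its carrier.\<close>

definition mk_dist ::
  "('t::metric_space set \<Rightarrow> 'k::real_or_complex ^ 'n) \<Rightarrow> ('t set \<Rightarrow> 'k ^ 'n) \<Rightarrow> real" where
  "mk_dist \<mu> \<nu> = (if \<mu> \<in> cabv \<and> \<nu> \<in> cabv then mk_norm (\<mu> - \<nu>) else 0)"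

definition weak_star :: "('t::topological_space set \<Rightarrow> 'k::real_or_complex ^ 'n) topology" where
  "weak_star = topology_generated_by
     {{\<mu> \<in> cabv. vint \<mu> f \<in> U} | f U. continuous_on UNIV f \<and> open U}"

end

theory Submission
  imports Defs
begin

text \<open>
  Two norms are at work. For the Monge-Kantorovich norm, let \<open>adj_op R\<close> be the adjoint of \<open>R\<close> with
  respect to the scalar product. Moving \<open>R\<close> and \<open>\<omega>\<close> to the integrand gives
  \<open>\<integral> f d(R \<circ> \<omega>(\<mu>)) = \<integral> (adj_op R \<circ> f \<circ> \<omega>) d\<mu>\<close> (lemma \<open>vint_op_image\<close>). If \<open>f\<close> has sup norm \<open>s\<close> and
  Lipschitz constant \<open>l\<close>, the new integrand has sup norm at most \<open>\<parallel>R\<parallel> s\<close> and Lipschitz constant at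
  most \<open>\<parallel>R\<parallel> l r\<close>, so its bounded Lipschitz norm is at most \<open>\<parallel>R\<parallel> (1 + r)\<close> when \<open>s + l \<le> 1\<close>.
  Summation yields the contraction factor \<open>d\<close> (lemma \<open>mk_norm_H_le\<close>).

  The fixed point is found in the variation norm. There \<open>H\<close> is bounded by \<open>\<Sum> \<parallel>R i\<parallel>\<close>, and this number
  is at most \<open>d < 1\<close> because each \<open>r i\<close> is nonnegative. As \<open>cabv\<close> is complete in the variation norm
  (lemma \<open>cabv_complete\<close>), the iterates of any point of \<open>A\<close> converge in variation. Convergence in
  variation implies weak* convergence, so the limit stays in the weak* closed set \<open>A\<close> (lemma
  \<open>variation_limit_in_weak_star_closed\<close>), and it is a fixed point. The difference of two fixed points is
  fixed by \<open>H\<close>, hence \<open>0\<close>; in the same way the fixed point is \<open>0\<close> when \<open>\<mu>0 = 0\<close>, which also shows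
  \<open>0 \<in> A\<close>.

  Two facts need a link between a vector measure and its integrals over continuous functions: that the
  Monge-Kantorovich norm separates points, and that the ball for the variation is weak* closed. Both
  come from the estimate \<open>\<bar>\<integral> f d\<mu>\<bar> \<le> \<integral> \<parallel>f\<parallel> d\<bar>\<mu>\<bar>\<close> by the variation measure (lemma \<open>norm_vint_le\<close>),
  combined with the density of the bounded Lipschitz functions, in the \<open>L\<^sup>1\<close> sense, at indicators of
  Borel sets (lemma \<open>bl_approx_indicator\<close>).
\<close>

section \<open>The scalar product and adjoint operators\<close>

lemma scnj_0: "scnj 0 = (0::'k::real_or_complex)"
  using scnj_add[of 0 "0::'k"] by simp

lemma norm_scnj: "norm (scnj x) = norm (x::'k::real_or_complex)"
proof (cases "x = 0")
  case False
  have "norm x * norm (scnj x) = norm x * norm x"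
    using arg_cong[OF mult_scnj[of x], of norm] by (simp add: norm_mult power2_eq_square)
  then show ?thesis using False by simp
qed (simp add: scnj_0)

lemma sprod_add_left: "sprod (x + y) z = sprod x z + sprod y z"
  by (simp add: sprod_def distrib_right sum.distrib)

lemma sprod_add_right: "sprod x (y + z) = sprod x y + sprod x z"
  by (simp add: sprod_def scnj_add distrib_left sum.distrib)

lemma sprod_scaleR_left: "sprod (c *\<^sub>R x) y = c *\<^sub>R sprod x y"
  by (simp add: sprod_def scaleR_sum_right)

lemma sprod_smult_right: "sprod x (c *s y) = sprod x y * scnj c"
  by (simp add: sprod_def scnj_mult sum_distrib_right mult.assoc mult.commute[of "scnj c"])

lemma sprod_0_left [simp]: "sprod 0 y = 0"
  by (simp add: sprod_def)

lemma sprod_0_right [simp]: "sprod x 0 = 0"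
  by (simp add: sprod_def scnj_0)

lemma sprod_sum_right: "sprod x (\<Sum>i\<in>I. f i) = (\<Sum>i\<in>I. sprod x (f i))"
  by (induction I rule: infinite_finite_induct) (auto simp: sprod_add_right)

lemma norm_sprod_le: "norm (sprod x y) \<le> norm x * norm y"
proof -
  have "norm (sprod x y) \<le> (\<Sum>i\<in>UNIV. norm (x $ i * scnj (y $ i)))"
    unfolding sprod_def by (rule norm_sum)
  also have "\<dots> = (\<Sum>i\<in>UNIV. \<bar>norm (x $ i)\<bar> * \<bar>norm (y $ i)\<bar>)"
    by (simp add: norm_mult norm_scnj)
  also have "\<dots> \<le> norm x * norm y"
    unfolding norm_vec_def by (rule L2_set_mult_ineq)
  finally show ?thesis .
qed

lemma sprod_self: "sprod x x = (norm x)\<^sup>2 *\<^sub>R 1"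
  by (simp add: sprod_def mult_scnj norm_vec_def L2_set_def sum_nonneg scaleR_left.sum)

lemma cont_lin_ops_expand:
  assumes "R \<in> cont_lin_ops"
  shows "R y = (\<Sum>j\<in>UNIV. (y $ j) *s R (axis j 1))"
proof -
  interpret Vector_Spaces.linear "(*s)" "(*s)" R
    using assms by (simp add: cont_lin_ops_def)
  have "R y = R (\<Sum>j\<in>UNIV. (y $ j) *s axis j 1)"
    by (simp add: basis_expansion)
  then show ?thesis by (simp add: sum scale)
qed

lemma cont_lin_ops_bounded_linear:
  fixes R :: "'k::real_or_complex ^ 'n \<Rightarrow> 'k ^ 'n"
  assumes "R \<in> cont_lin_ops"
  shows "bounded_linear R"
proof -
  interpret Vector_Spaces.linear "(*s)" "(*s)" R
    using assms by (simp add: cont_lin_ops_def)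
  have *: "c *\<^sub>R x = (of_real c :: 'k) *s x" for c and x :: "'k ^ 'n"
    by (rule vec_eq_iff[THEN iffD2]) (simp add: scaleR_conv_of_real[where 'a = 'k])
  have "Real_Vector_Spaces.linear R"
    by (rule linearI) (auto simp: add * scale)
  then show ?thesis by (rule linear_conv_bounded_linear[THEN iffD1])
qed

text \<open>
  The adjoint for \<open>sprod\<close>: its \<open>j\<close>-th coordinate is forced by testing against the \<open>j\<close>-th unit vector.
\<close>

definition adj_op :: "('k::real_or_complex ^ 'n \<Rightarrow> 'k ^ 'n) \<Rightarrow> 'k ^ 'n \<Rightarrow> 'k ^ 'n" where
  "adj_op R x = (\<chi> j. sprod x (R (axis j 1)))"

lemma sprod_adj_op:
  assumes "R \<in> cont_lin_ops"
  shows "sprod (adj_op R x) y = sprod x (R y)"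
proof -
  have "sprod (adj_op R x) y = (\<Sum>j\<in>UNIV. sprod x (R (axis j 1)) * scnj (y $ j))"
    by (simp add: adj_op_def sprod_def)
  also have "\<dots> = sprod x (R y)"
    by (simp add: cont_lin_ops_expand[OF assms, of y] sprod_sum_right sprod_smult_right)
  finally show ?thesis .
qed

text \<open>
  With \<open>y = adj_op R x\<close>, one has \<open>\<parallel>y\<parallel>\<^sup>2 = \<bar>\<langle>x, R y\<rangle>\<bar> \<le> \<parallel>x\<parallel> \<parallel>R\<parallel> \<parallel>y\<parallel>\<close>, and \<open>\<parallel>y\<parallel>\<close> cancels.
\<close>

lemma norm_adj_op_le:
  assumes R: "R \<in> cont_lin_ops"
  shows "norm (adj_op R x) \<le> onorm R * norm x"
proof (cases "adj_op R x = 0")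
  case True
  then show ?thesis
    by (simp add: onorm_pos_le[OF cont_lin_ops_bounded_linear[OF R]])
next
  case False
  have "norm (adj_op R x) * norm (adj_op R x) = norm (sprod (adj_op R x) (adj_op R x))"
    by (simp add: sprod_self power2_eq_square)
  also have "\<dots> = norm (sprod x (R (adj_op R x)))"
    by (simp add: sprod_adj_op[OF R])
  also have "\<dots> \<le> norm x * norm (R (adj_op R x))" by (rule norm_sprod_le)
  also have "\<dots> \<le> norm x * (onorm R * norm (adj_op R x))"
    by (intro mult_left_mono onorm[OF cont_lin_ops_bounded_linear[OF R]]) auto
  finally have "norm (adj_op R x) * norm (adj_op R x) \<le> (onorm R * norm x) * norm (adj_op R x)"
    by (simp add: mult_ac)
  then show ?thesis using False by simp
qed

lemma bounded_linear_adj_op: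
  assumes "R \<in> cont_lin_ops"
  shows "bounded_linear (adj_op R)"
proof (rule bounded_linear_intro[where K = "onorm R"])
  show "norm (adj_op R x) \<le> norm x * onorm R" for x
    using norm_adj_op_le[OF assms, of x] by (simp add: mult.commute)
qed (auto simp: adj_op_def vec_eq_iff sprod_add_left sprod_scaleR_left)

section \<open>Vector measures and their variation measures\<close>

lemma cabvD:
  assumes "\<mu> \<in> cabv"
  shows cabv_nonborel: "B \<notin> sets borel \<Longrightarrow> \<mu> B = 0"
    and cabv_sums: "range A \<subseteq> sets borel \<Longrightarrow> disjoint_family (A :: nat \<Rightarrow> _) \<Longrightarrow> (\<lambda>i. \<mu> (A i)) sums \<mu> (\<Union>i. A i)"
    and cabv_variation: "variation \<mu> < \<infinity>"
  using assms by (auto simp: cabv_def)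

lemma cabv_empty:
  assumes "\<mu> \<in> cabv"
  shows "\<mu> {} = 0"
proof -
  have "(\<lambda>i::nat. \<mu> {}) sums \<mu> {}"
    using cabv_sums[OF assms, of "\<lambda>_. {}"] by (simp add: disjoint_family_on_def)
  then have "summable (\<lambda>i::nat. \<mu> {})" by (simp add: sums_iff)
  then show ?thesis by (simp add: summable_const_iff)
qed

lemma cabv_Un:
  assumes \<mu>: "\<mu> \<in> cabv" and AB: "A \<in> sets borel" "B \<in> sets borel" "A \<inter> B = {}"
  shows "\<mu> (A \<union> B) = \<mu> A + \<mu> B"
proof -
  have "(\<lambda>i. \<mu> (binaryset A B i)) sums \<mu> (\<Union>i. binaryset A B i)"
    using AB by (intro cabv_sums[OF \<mu>])
      (auto simp: disjoint_family_on_def binaryset_def split: if_splits)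
  moreover have "(\<lambda>i. \<mu> (binaryset A B i)) sums (\<mu> A + \<mu> B)"
    by (rule binaryset_sums) (rule cabv_empty[OF \<mu>])
  ultimately show ?thesis
    by (simp add: UN_binaryset_eq sums_unique2)
qed

lemma cabv_finite_UN:
  assumes \<mu>: "\<mu> \<in> cabv" and "finite I" "disjoint_family_on D I" "\<And>i. i \<in> I \<Longrightarrow> D i \<in> sets borel"
  shows "\<mu> (\<Union>i\<in>I. D i) = (\<Sum>i\<in>I. \<mu> (D i))"
  using assms(2-4)
proof (induction I)
  case (insert i I)
  have "D i \<inter> (\<Union>i\<in>I. D i) = {}"
    using insert.prems(1) insert.hyps(2) by (fastforce simp: disjoint_family_on_def)
  then have "\<mu> (D i \<union> (\<Union>i\<in>I. D i)) = \<mu> (D i) + \<mu> (\<Union>i\<in>I. D i)"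
    using insert by (intro cabv_Un[OF \<mu>]) auto
  then show ?case
    using insert by (simp add: disjoint_family_on_def)
qed (simp add: cabv_empty[OF \<mu>])

text \<open>
  The variation \<open>\<bar>\<mu>\<bar>(B)\<close>. The partitions consist of nonempty sets, as in the definition of \<open>variation\<close>,
  which is the case \<open>B = UNIV\<close>.
\<close>

definition var_on :: "('t::topological_space set \<Rightarrow> 'b::real_normed_vector) \<Rightarrow> 't set \<Rightarrow> ennreal" where
  "var_on \<mu> B =
     (SUP P \<in> {P. finite P \<and> partition_on B P \<and> P \<subseteq> sets borel}. \<Sum>A\<in>P. ennreal (norm (\<mu> A)))"

lemma variation_eq_var_on: "variation \<mu> = var_on \<mu> UNIV"
  by (simp add: variation_def var_on_def)

text \<open>
  In practice one meets disjoint families that need not cover \<open>B\<close> and may contain empty sets. Dropping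
  the empty members and adding the uncovered rest of \<open>B\<close> gives a genuine partition with a sum that is
  at least as large.
\<close>

lemma sum_le_var_on:
  assumes "\<mu> {} = 0" "finite I" "disjoint_family_on D I" "\<And>i. i \<in> I \<Longrightarrow> D i \<in> sets borel"
    and B: "B \<in> sets borel" "(\<Union>i\<in>I. D i) \<subseteq> B"
  shows "(\<Sum>i\<in>I. ennreal (norm (\<mu> (D i)))) \<le> var_on \<mu> B"
proof -
  define J where "J = {i\<in>I. D i \<noteq> {}}"
  define P where "P = insert (B - (\<Union>i\<in>I. D i)) (D ` J) - {{}}"
  have inj: "inj_on D J"
    using assms(3) by (force simp: J_def inj_on_def disjoint_family_on_def)
  have "disjoint P"
  proof (rule pairwiseI)
    fix S S' assume S: "S \<in> P" "S' \<in> P" "S \<noteq> S'"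
    have DD: "disjnt (D i) (D j)" if "i \<in> J" "j \<in> J" "D i \<noteq> D j" for i j
      using assms(3) that unfolding disjnt_def
      by (metis (mono_tags, lifting) J_def disjoint_family_on_def mem_Collect_eq)
    have DB: "disjnt (D i) (B - (\<Union>i\<in>I. D i))" if "i \<in> J" for i
      using that by (auto simp: J_def disjnt_def)
    have "S = B - (\<Union>i\<in>I. D i) \<or> (\<exists>i\<in>J. S = D i)" "S' = B - (\<Union>i\<in>I. D i) \<or> (\<exists>i\<in>J. S' = D i)"
      using S unfolding P_def by blast+
    then show "disjnt S S'"
      using S(3) DD DB disjnt_sym by metis
  qed
  moreover have "\<Union>P = B"
  proof -
    have "\<Union>P = (B - (\<Union>i\<in>I. D i)) \<union> (\<Union>i\<in>J. D i)"
      unfolding P_def by blast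
    also have "(\<Union>i\<in>J. D i) = (\<Union>i\<in>I. D i)"
      by (auto simp: J_def)
    finally show ?thesis using B(2) by blast
  qed
  ultimately have part: "partition_on B P"
    by (simp add: partition_on_def P_def)
  have fin: "finite P" "finite J" using assms(2) by (auto simp: P_def J_def)
  have sets: "P \<subseteq> sets borel"
    using assms(2,4) B(1) by (auto simp: P_def J_def intro!: sets.Diff sets.finite_UN)
  have "(\<Sum>i\<in>I. ennreal (norm (\<mu> (D i)))) = (\<Sum>i\<in>J. ennreal (norm (\<mu> (D i))))"
    using assms(1,2) by (intro sum.mono_neutral_right) (auto simp: J_def)
  also have "\<dots> = (\<Sum>A\<in>D ` J. ennreal (norm (\<mu> A)))"
    by (simp add: sum.reindex[OF inj])
  also have "\<dots> \<le> (\<Sum>A\<in>P. ennreal (norm (\<mu> A)))"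
    using fin by (intro sum_mono2) (auto simp: P_def J_def)
  also have "\<dots> \<le> var_on \<mu> B"
    unfolding var_on_def by (rule SUP_upper) (use part fin sets in auto)
  finally show ?thesis .
qed

lemma norm_le_var_on:
  assumes "\<mu> {} = 0" "B \<in> sets borel"
  shows "ennreal (norm (\<mu> B)) \<le> var_on \<mu> B"
  using sum_le_var_on[where \<mu> = \<mu> and I = "{()}" and D = "\<lambda>_. B" and B = B] assms by (simp add: disjoint_family_on_def)

lemma var_on_empty: "var_on (\<mu> :: 'a::topological_space set \<Rightarrow> _) {} = 0"
proof -
  have "P = {}" if "partition_on {} P" for P :: "'a set set"
  proof (rule equals0I)
    fix S assume "S \<in> P"
    then have "S = {}" using that by (auto simp: partition_on_def)
    then show False using \<open>S \<in> P\<close> that by (simp add: partition_on_def)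
  qed
  then have "{P. finite P \<and> partition_on {} P \<and> P \<subseteq> sets borel} = {{} :: 'a set set}"
    by (auto simp: partition_on_def)
  then show ?thesis by (simp add: var_on_def)
qed

lemma var_on_nonempty:
  assumes "B \<in> sets borel"
  shows "{P. finite P \<and> partition_on B P \<and> P \<subseteq> sets borel} \<noteq> {}"
proof (cases "B = {}")
  case True
  then show ?thesis by (auto simp: partition_on_def intro!: exI[of _ "{}"])
next
  case False
  then show ?thesis using assms by (auto simp: partition_on_def intro!: exI[of _ "{B}"])
qed

lemma var_on_mono:
  assumes "\<mu> {} = 0" "C \<in> sets borel" "B \<subseteq> C"
  shows "var_on \<mu> B \<le> var_on \<mu> C"
  unfolding var_on_def[of \<mu> B]
proof (rule SUP_least, clarify)
  fix P assume "finite P" "partition_on B P" "P \<subseteq> sets borel"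
  then show "(\<Sum>A\<in>P. ennreal (norm (\<mu> A))) \<le> var_on \<mu> C"
    using assms by (intro sum_le_var_on)
      (auto simp: partition_on_def disjoint_def disjoint_family_on_def)
qed

lemma var_on_superadditive:
  assumes "\<mu> {} = 0" "B \<in> sets borel" "C \<in> sets borel" "B \<inter> C = {}"
  shows "var_on \<mu> B + var_on \<mu> C \<le> var_on \<mu> (B \<union> C)"
proof -
  let ?PP = "\<lambda>B. {P. finite P \<and> partition_on B P \<and> P \<subseteq> sets borel}"
  let ?S = "\<lambda>P. \<Sum>A\<in>P. ennreal (norm (\<mu> A))"
  have PQ: "?S P + ?S Q \<le> var_on \<mu> (B \<union> C)" if "P \<in> ?PP B" "Q \<in> ?PP C" for P Q
  proof -
    have partition_onUn: "partition_on (B \<union> C) (P \<union> Q)"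
      using that assms(4) by (simp add: partition_on_def disjoint_union)
    have disj: "P \<inter> Q = {}"
    proof (rule equals0I)
      fix S assume "S \<in> P \<inter> Q"
      then have "S \<subseteq> B" "S \<subseteq> C" "S \<noteq> {}"
        using that by (auto simp: partition_on_def)
      then show False using assms(4) by blast
    qed
    have "?S P + ?S Q = ?S (P \<union> Q)"
      using that disj by (intro sum.union_disjoint[symmetric]) auto
    also have "\<dots> \<le> var_on \<mu> (B \<union> C)"
      unfolding var_on_def
      by (rule SUP_upper) (use that partition_onUn in \<open>simp\<close>)
    finally show ?thesis .
  qed
  have "var_on \<mu> B + var_on \<mu> C = (SUP P\<in>?PP B. ?S P + var_on \<mu> C)"
    using ennreal_SUP_add_left[OF var_on_nonempty[OF assms(2)]] by (simp add: var_on_def)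
  also have "\<dots> \<le> var_on \<mu> (B \<union> C)"
  proof (rule SUP_least)
    fix P assume P: "P \<in> ?PP B"
    have "?S P + var_on \<mu> C = (SUP Q\<in>?PP C. ?S P + ?S Q)"
      using ennreal_SUP_add_right[OF var_on_nonempty[OF assms(3)]] by (simp add: var_on_def)
    also have "\<dots> \<le> var_on \<mu> (B \<union> C)"
      using PQ[OF P] by (intro SUP_least) auto
    finally show "?S P + var_on \<mu> C \<le> var_on \<mu> (B \<union> C)" .
  qed
  finally show ?thesis .
qed

text \<open>
  Superadditivity on finitely many pieces gives one inequality. For the other, a partition of the union
  is cut along the sets \<open>E m\<close>; each of its members satisfies \<open>\<mu> A = (\<Sum>m. \<mu> (A \<inter> E m))\<close>, and the two
  sums of norms may be exchanged.
\<close>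

lemma var_on_suminf:
  assumes \<mu>: "\<mu> \<in> cabv" and E: "range E \<subseteq> sets borel" "disjoint_family (E :: nat \<Rightarrow> _)"
  shows "(\<Sum>m. var_on \<mu> (E m)) = var_on \<mu> (\<Union>m. E m)"
proof (rule antisym)
  note e = cabv_empty[OF \<mu>]
  have Es: "E m \<in> sets borel" for m using E(1) by auto
  have fin: "(\<Sum>m<N. var_on \<mu> (E m)) \<le> var_on \<mu> (\<Union>m<N. E m)" for N
  proof (induction N)
    case 0
    then show ?case by simp
  next
    case (Suc N)
    have "(\<Sum>m<Suc N. var_on \<mu> (E m)) \<le> var_on \<mu> (\<Union>m<N. E m) + var_on \<mu> (E N)"
      using Suc by (simp add: add_right_mono)
    also have "\<dots> \<le> var_on \<mu> ((\<Union>m<N. E m) \<union> E N)"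
    proof (intro var_on_superadditive e)
      show "(\<Union>m<N. E m) \<inter> E N = {}"
        using disjoint_family_onD[OF E(2), of _ N] by fastforce
    qed (use Es in auto)
    also have "(\<Union>m<N. E m) \<union> E N = (\<Union>m<Suc N. E m)"
      by (auto simp: less_Suc_eq)
    finally show ?case .
  qed
  have "var_on \<mu> (\<Union>m<N. E m) \<le> var_on \<mu> (\<Union>m. E m)" for N
    using Es by (intro var_on_mono e) auto
  then show "(\<Sum>m. var_on \<mu> (E m)) \<le> var_on \<mu> (\<Union>m. E m)"
    by (intro suminf_le_const order_trans[OF fin]) auto
next
  note e = cabv_empty[OF \<mu>]
  have Es: "E m \<in> sets borel" for m using E(1) by auto
  show "var_on \<mu> (\<Union>m. E m) \<le> (\<Sum>m. var_on \<mu> (E m))"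
    unfolding var_on_def[of \<mu> "\<Union>m. E m"]
  proof (rule SUP_least, clarify)
    fix P assume P: "finite P" "partition_on (\<Union>m. E m) P" "P \<subseteq> sets borel"
    have le: "ennreal (norm (\<mu> A)) \<le> (\<Sum>m. ennreal (norm (\<mu> (A \<inter> E m))))" if "A \<in> P" for A
    proof -
      have A: "A \<in> sets borel" "A = (\<Union>m. A \<inter> E m)"
        using P that by (auto simp: partition_on_def)
      have "disjoint_family (\<lambda>m. A \<inter> E m)"
        using E(2) unfolding disjoint_family_on_def by fast
      then have "(\<lambda>m. \<mu> (A \<inter> E m)) sums \<mu> A"
        using cabv_sums[OF \<mu>, of "\<lambda>m. A \<inter> E m"] A(1) Es
        by (simp add: image_subset_iff flip: A(2) del: UN_simps)
      then have lim: "(\<lambda>N. ennreal (norm (\<Sum>m<N. \<mu> (A \<inter> E m)))) \<longlonglongrightarrow> ennreal (norm (\<mu> A))"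
        by (auto simp: sums_def intro!: tendsto_intros)
      have "ennreal (norm (\<Sum>m<N. \<mu> (A \<inter> E m))) \<le> (\<Sum>m. ennreal (norm (\<mu> (A \<inter> E m))))" for N
      proof -
        have "ennreal (norm (\<Sum>m<N. \<mu> (A \<inter> E m))) \<le> (\<Sum>m<N. ennreal (norm (\<mu> (A \<inter> E m))))"
          by (simp add: sum_ennreal norm_sum ennreal_leI)
        also have "\<dots> \<le> (\<Sum>m. ennreal (norm (\<mu> (A \<inter> E m))))"
          by (intro sum_le_suminf) auto
        finally show ?thesis .
      qed
      then show ?thesis
        by (intro LIMSEQ_le_const2[OF lim] exI[of _ 0] allI impI)
    qed
    have "(\<Sum>A\<in>P. ennreal (norm (\<mu> A))) \<le> (\<Sum>A\<in>P. \<Sum>m. ennreal (norm (\<mu> (A \<inter> E m))))"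
      by (intro sum_mono le)
    also have "\<dots> = (\<Sum>m. \<Sum>A\<in>P. ennreal (norm (\<mu> (A \<inter> E m))))"
      by (rule suminf_sum[symmetric]) auto
    also have "\<dots> \<le> (\<Sum>m. var_on \<mu> (E m))"
    proof (intro suminf_le allI)
      show "(\<Sum>A\<in>P. ennreal (norm (\<mu> (A \<inter> E m)))) \<le> var_on \<mu> (E m)" for m
      proof (intro sum_le_var_on e)
        show "disjoint_family_on (\<lambda>A. A \<inter> E m) P"
          using P(2) unfolding partition_on_def disjoint_def disjoint_family_on_def by fast
      qed (use P Es in auto)
    qed auto
    finally show "(\<Sum>A\<in>P. ennreal (norm (\<mu> A))) \<le> (\<Sum>m. var_on \<mu> (E m))" .
  qed
qed

text \<open>
  As an ordinary finite measure, \<open>\<bar>\<mu>\<bar>\<close> gives access to the Lebesgue integral and to dominated convergence.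
\<close>

definition var_measure :: "('t::topological_space set \<Rightarrow> 'b::real_normed_vector) \<Rightarrow> 't measure" where
  "var_measure \<mu> = measure_of UNIV (sets borel) (var_on \<mu>)"

lemma space_var_measure [simp]: "space (var_measure \<mu>) = UNIV"
  by (simp add: var_measure_def space_measure_of_conv)

lemma sets_var_measure [simp, measurable_cong]: "sets (var_measure \<mu>) = sets borel"
  by (metis sets.sets_measure_of_eq space_borel var_measure_def)

lemma emeasure_var_measure:
  fixes \<mu> :: "'t::topological_space set \<Rightarrow> 'b::real_normed_vector"
  assumes "\<mu> \<in> cabv" "B \<in> sets borel"
  shows "emeasure (var_measure \<mu>) B = var_on \<mu> B"
  unfolding var_measure_def
proof (rule emeasure_measure_of_sigma)
  show "sigma_algebra UNIV (sets (borel :: 't measure))"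
    using sets.sigma_algebra_axioms[of borel] by simp
  show "countably_additive (sets borel) (var_on \<mu>)"
    by (rule countably_additiveI) (rule var_on_suminf[OF assms(1)])
  show "positive (sets borel) (var_on \<mu>)"
    by (simp add: positive_def var_on_empty)
qed (rule assms(2))

lemma finite_measure_var_measure:
  assumes "\<mu> \<in> cabv"
  shows "finite_measure (var_measure \<mu>)"
proof (rule finite_measureI)
  show "emeasure (var_measure \<mu>) (space (var_measure \<mu>)) \<noteq> \<infinity>"
    using cabv_variation[OF assms]
    unfolding space_var_measure emeasure_var_measure[OF assms sets.top[of borel, unfolded space_borel]] variation_eq_var_on
    by (rule less_imp_neq)
qed

lemma ennreal_measure_var_measure:
  assumes "\<mu> \<in> cabv" "B \<in> sets borel"
  shows "ennreal (measure (var_measure \<mu>) B) = var_on \<mu> B"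
  using finite_measure.emeasure_eq_measure[OF finite_measure_var_measure[OF assms(1)], of B]
  unfolding emeasure_var_measure[OF assms] by (rule sym)

lemma ennreal_measure_var_measure_UNIV:
  "\<mu> \<in> cabv \<Longrightarrow> ennreal (measure (var_measure \<mu>) UNIV) = variation \<mu>"
  unfolding variation_eq_var_on by (intro ennreal_measure_var_measure) auto

lemma norm_le_measure_var_measure:
  assumes "\<mu> \<in> cabv" "B \<in> sets borel"
  shows "norm (\<mu> B) \<le> measure (var_measure \<mu>) B"
  using norm_le_var_on[of \<mu>, OF cabv_empty[OF assms(1)] assms(2)]
  unfolding ennreal_measure_var_measure[OF assms, symmetric] by simp

section \<open>Sums and images of vector measures\<close>

lemma cabv_0: "0 \<in> cabv"
proof -
  have "variation (0 :: 'a set \<Rightarrow> 'b) = 0"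
    by (simp add: variation_def SUP_constant zero_fun_def bot_ennreal)
  then show ?thesis by (simp add: cabv_def zero_fun_def sums_zero)
qed

lemma variation_add_le:
  fixes \<mu> \<nu> :: "'t::topological_space set \<Rightarrow> 'b::real_normed_vector"
  shows "variation (\<mu> + \<nu>) \<le> variation \<mu> + variation \<nu>"
  unfolding variation_def[of "\<mu> + \<nu>"]
proof (rule SUP_least)
  fix P :: "'t set set"
  assume P: "P \<in> {P. finite P \<and> partition_on UNIV P \<and> P \<subseteq> sets borel}"
  have "(\<Sum>A\<in>P. ennreal (norm ((\<mu> + \<nu>) A))) \<le> (\<Sum>A\<in>P. ennreal (norm (\<mu> A)) + ennreal (norm (\<nu> A)))"
    by (intro sum_mono) (simp add: norm_triangle_ineq flip: ennreal_plus)
  also have "\<dots> = (\<Sum>A\<in>P. ennreal (norm (\<mu> A))) + (\<Sum>A\<in>P. ennreal (norm (\<nu> A)))"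
    by (rule sum.distrib)
  also have "\<dots> \<le> variation \<mu> + variation \<nu>"
    unfolding variation_def using P by (intro add_mono SUP_upper)
  finally show "(\<Sum>A\<in>P. ennreal (norm ((\<mu> + \<nu>) A))) \<le> variation \<mu> + variation \<nu>" .
qed

lemma variation_uminus: "variation (- \<mu>) = variation \<mu>"
  by (simp add: variation_def)

lemma variation_diff_le: "variation (\<mu> - \<nu>) \<le> variation \<mu> + variation \<nu>"
  using variation_add_le[of \<mu> "- \<nu>"] by (simp add: variation_uminus)

lemma cabv_add:
  assumes "\<mu> \<in> cabv" "\<nu> \<in> cabv"
  shows "\<mu> + \<nu> \<in> cabv"
proof -
  have "variation (\<mu> + \<nu>) < \<infinity>"
    using variation_add_le[of \<mu> \<nu>] cabv_variation[OF assms(1)] cabv_variation[OF assms(2)]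
    by (auto intro: le_less_trans)
  moreover have "(\<lambda>i. (\<mu> + \<nu>) (A i)) sums (\<mu> + \<nu>) (\<Union>i. A i)"
    if "range A \<subseteq> sets borel" "disjoint_family A" for A :: "nat \<Rightarrow> _"
    using sums_add[OF cabv_sums[OF assms(1) that] cabv_sums[OF assms(2) that]] by simp
  ultimately show ?thesis
    using assms by (simp add: cabv_def)
qed

lemma variation_op_image_le:
  fixes \<mu> :: "'t::topological_space set \<Rightarrow> 'b::real_normed_vector"
  assumes \<mu>: "\<mu> \<in> cabv" and R: "bounded_linear R" and h: "h \<in> borel_measurable borel"
  shows "variation (op_image R h \<mu>) \<le> ennreal (onorm R) * variation \<mu>"
  unfolding variation_def[of "op_image R h \<mu>"]
proof (rule SUP_least)
  fix P :: "'t set set"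
  assume P: "P \<in> {P. finite P \<and> partition_on UNIV P \<and> P \<subseteq> sets borel}"
  have "(\<Sum>A\<in>P. ennreal (norm (op_image R h \<mu> A))) \<le> (\<Sum>A\<in>P. ennreal (onorm R) * ennreal (norm (\<mu> (h -` A))))"
  proof (rule sum_mono)
    fix A assume "A \<in> P"
    then have "op_image R h \<mu> A = R (\<mu> (h -` A))"
      using P by (auto simp: op_image_def)
    then show "ennreal (norm (op_image R h \<mu> A)) \<le> ennreal (onorm R) * ennreal (norm (\<mu> (h -` A)))"
      using onorm[OF R, of "\<mu> (h -` A)"] onorm_pos_le[OF R] by (simp flip: ennreal_mult)
  qed
  also have "\<dots> = ennreal (onorm R) * (\<Sum>A\<in>P. ennreal (norm (\<mu> (h -` A))))"
    by (rule sum_distrib_left[symmetric])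
  also have "(\<Sum>A\<in>P. ennreal (norm (\<mu> (h -` A)))) \<le> variation \<mu>"
    unfolding variation_eq_var_on
  proof (rule sum_le_var_on)
    show "h -` A \<in> sets borel" if "A \<in> P" for A
      using P that measurable_sets[OF h, of A] by auto
    show "disjoint_family_on ((-`) h) P"
      using P unfolding disjoint_family_on_def partition_on_def disjoint_def by fast
  qed (use P cabv_empty[OF \<mu>] in auto)
  finally show "(\<Sum>A\<in>P. ennreal (norm (op_image R h \<mu> A))) \<le> ennreal (onorm R) * variation \<mu>"
    by (simp add: mult_left_mono)
qed

lemma cabv_op_image:
  fixes \<mu> :: "'t::topological_space set \<Rightarrow> 'b::real_normed_vector"
  assumes \<mu>: "\<mu> \<in> cabv" and R: "bounded_linear R" and h: "h \<in> borel_measurable borel"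
  shows "op_image R h \<mu> \<in> cabv"
proof -
  have "variation (op_image R h \<mu>) < \<infinity>"
    using variation_op_image_le[OF assms] cabv_variation[OF \<mu>]
    by (auto intro!: le_less_trans[OF variation_op_image_le[OF assms]] ennreal_mult_less_top[THEN iffD2])
  moreover have "(\<lambda>i. op_image R h \<mu> (A i)) sums op_image R h \<mu> (\<Union>i. A i)"
    if A: "range A \<subseteq> sets borel" "disjoint_family A" for A :: "nat \<Rightarrow> _"
  proof -
    have Ai: "A i \<in> sets borel" for i using A(1) by auto
    have "h -` A i \<in> sets borel" for i
      using measurable_sets[OF h Ai] by simp
    moreover have "disjoint_family (\<lambda>i. h -` A i)"
      using A(2) unfolding disjoint_family_on_def by fast
    ultimately have "(\<lambda>i. \<mu> (h -` A i)) sums \<mu> (\<Union>i. h -` A i)"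
      by (intro cabv_sums[OF \<mu>]) auto
    then show ?thesis
      using bounded_linear.sums[OF R] Ai by (simp add: op_image_def vimage_UN sets.countable_UN)
  qed
  ultimately show ?thesis
    by (simp add: cabv_def op_image_def)
qed

lemma cabv_diff:
  fixes \<mu> \<nu> :: "'t::topological_space set \<Rightarrow> 'b::real_normed_vector"
  assumes "\<mu> \<in> cabv" "\<nu> \<in> cabv"
  shows "\<mu> - \<nu> \<in> cabv"
proof -
  have "- \<nu> \<in> cabv"
    using assms(2) by (simp add: cabv_def variation_uminus sums_minus)
  then show ?thesis using cabv_add[OF assms(1), of "- \<nu>"] by simp
qed

section \<open>The integral\<close>

text \<open>
  The definition uses the coarsest partition on which a simple function is constant. Any finer
  partition, given by the level sets of a simple function \<open>g\<close>, yields the same value; with a common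
  refinement of two simple functions at hand, linearity follows.
\<close>

lemma simple_vint_compose:
  fixes \<mu> :: "'t::topological_space set \<Rightarrow> 'k::real_or_complex ^ 'n"
  assumes \<mu>: "\<mu> \<in> cabv" and g: "simple_function borel g"
  shows "simple_vint \<mu> (\<lambda>x. \<phi> (g x)) = (\<Sum>y\<in>range g. sprod (\<phi> y) (\<mu> (g -` {y})))"
proof -
  have fin: "finite (range g)" and meas: "g -` {y} \<in> sets borel" for y
    using simple_functionD[OF g] by auto
  have "sprod x (\<mu> ((\<lambda>x. \<phi> (g x)) -` {x})) = (\<Sum>y\<in>{y. y \<in> range g \<and> \<phi> y = x}. sprod (\<phi> y) (\<mu> (g -` {y})))" for x
  proof -
    have "(\<lambda>x. \<phi> (g x)) -` {x} = (\<Union>y\<in>{y. y \<in> range g \<and> \<phi> y = x}. g -` {y})"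
      by auto
    also have "\<mu> \<dots> = (\<Sum>y\<in>{y. y \<in> range g \<and> \<phi> y = x}. \<mu> (g -` {y}))"
      using fin meas by (intro cabv_finite_UN[OF \<mu>]) (auto simp: disjoint_family_on_def)
    finally show ?thesis
      by (auto simp: sprod_sum_right intro!: sum.cong)
  qed
  then have "simple_vint \<mu> (\<lambda>x. \<phi> (g x)) =
      (\<Sum>x\<in>\<phi> ` range g. \<Sum>y\<in>{y. y \<in> range g \<and> \<phi> y = x}. sprod (\<phi> y) (\<mu> (g -` {y})))"
    by (simp add: simple_vint_def image_image)
  also have "\<dots> = (\<Sum>y\<in>range g. sprod (\<phi> y) (\<mu> (g -` {y})))"
    by (rule sum.image_gen[OF fin, symmetric])
  finally show ?thesis .
qed

lemma simple_vint_lincomb: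
  assumes \<mu>: "\<mu> \<in> cabv" and fg: "simple_function borel f" "simple_function borel g"
  shows "simple_vint \<mu> (\<lambda>x. f x + c *\<^sub>R g x) = simple_vint \<mu> f + c *\<^sub>R simple_vint \<mu> g"
proof -
  let ?h = "\<lambda>x. (f x, g x)"
  have h: "simple_function borel ?h" using fg by auto
  show ?thesis
    using simple_vint_compose[OF \<mu> h, of "\<lambda>(x, y). x + c *\<^sub>R y"]
      simple_vint_compose[OF \<mu> h, of fst] simple_vint_compose[OF \<mu> h, of snd]
    by (simp add: case_prod_beta sprod_add_left sprod_scaleR_left sum.distrib scaleR_sum_right)
qed

definition bounded_borel :: "('t::topological_space \<Rightarrow> 'b::euclidean_space) \<Rightarrow> bool" where
  "bounded_borel f \<longleftrightarrow> f \<in> borel_measurable borel \<and> bounded (range f)"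

lemma bounded_borelI:
  "f \<in> borel_measurable borel \<Longrightarrow> (\<And>x. norm (f x) \<le> C) \<Longrightarrow> bounded_borel f"
  by (auto simp: bounded_borel_def bounded_iff)

lemma bounded_borelE:
  assumes "bounded_borel f"
  obtains C where "f \<in> borel_measurable borel" "\<And>x. norm (f x) \<le> C" "C \<ge> 0"
proof -
  from assms obtain C where "\<forall>x. norm (f x) \<le> C" and m: "f \<in> borel_measurable borel"
    by (auto simp: bounded_borel_def bounded_iff)
  then have "norm (f x) \<le> max C 0" for x by (simp add: le_max_iff_disj)
  then show ?thesis using m by (intro that[of "max C 0"]) auto
qed

lemma bounded_borel_lincomb:
  assumes "bounded_borel f" "bounded_borel g"
  shows "bounded_borel (\<lambda>x. f x + c *\<^sub>R g x)"
proof -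
  from assms obtain C D where [measurable]: "f \<in> borel_measurable borel" "g \<in> borel_measurable borel"
    and *: "\<And>x. norm (f x) \<le> C" "\<And>x. norm (g x) \<le> D"
    by (elim bounded_borelE) blast
  have "norm (f x + c *\<^sub>R g x) \<le> C + \<bar>c\<bar> * D" for x
    using *[of x] norm_triangle_ineq[of "f x" "c *\<^sub>R g x"] mult_left_mono[of "norm (g x)" D "\<bar>c\<bar>"] by simp
  then show ?thesis by (intro bounded_borelI) simp_all
qed

lemma bounded_borel_simple:
  "simple_function borel f \<Longrightarrow> bounded_borel f"
  by (simp add: bounded_borel_def borel_measurable_simple_function simple_functionD(1)[of borel f, simplified] finite_imp_bounded)

lemma integrable_var_measure:
  assumes \<mu>: "\<mu> \<in> cabv" and f: "bounded_borel f"
  shows "integrable (var_measure \<mu>) (\<lambda>x. norm (f x))"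
proof -
  interpret finite_measure "var_measure \<mu>" by (rule finite_measure_var_measure[OF \<mu>])
  from f obtain C where [measurable]: "f \<in> borel_measurable borel" and *: "\<And>x. norm (f x) \<le> C"
    by (elim bounded_borelE) blast
  show ?thesis using * by (intro integrable_const_bound[where B = C]) auto
qed

lemma norm_simple_vint_le:
  fixes \<mu> :: "'t::topological_space set \<Rightarrow> 'k::real_or_complex ^ 'n"
  assumes \<mu>: "\<mu> \<in> cabv" and f: "simple_function borel f"
  shows "norm (simple_vint \<mu> f) \<le> (\<integral>x. norm (f x) \<partial>var_measure \<mu>)"
proof -
  interpret finite_measure "var_measure \<mu>" by (rule finite_measure_var_measure[OF \<mu>])
  have fin: "finite (range f)" and meas: "f -` {y} \<in> sets borel" for y
    using simple_functionD[OF f] by auto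
  have "norm (simple_vint \<mu> f) \<le> (\<Sum>y\<in>range f. norm (sprod y (\<mu> (f -` {y}))))"
    unfolding simple_vint_def by (rule norm_sum)
  also have "\<dots> \<le> (\<Sum>y\<in>range f. norm y * measure (var_measure \<mu>) (f -` {y}))"
    by (intro sum_mono order_trans[OF norm_sprod_le] mult_left_mono norm_le_measure_var_measure \<mu> meas) auto
  also have "\<dots> = (\<Sum>y\<in>range f. \<integral>x. norm y * indicator (f -` {y}) x \<partial>var_measure \<mu>)"
    using meas by simp
  also have "\<dots> = (\<integral>x. (\<Sum>y\<in>range f. norm y * indicator (f -` {y}) x) \<partial>var_measure \<mu>)"
    using meas by (intro Bochner_Integration.integral_sum[symmetric] integrable_mult_right)
      (auto simp: less_top[symmetric] emeasure_eq_measure)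
  also have "(\<lambda>x. \<Sum>y\<in>range f. norm y * indicator (f -` {y}) x) = (\<lambda>x. norm (f x))"
  proof
    fix x
    have "(\<Sum>y\<in>range f. norm y * indicator (f -` {y}) x) = (\<Sum>y\<in>range f. if y = f x then norm y else 0)"
      by (intro sum.cong) (auto simp: indicator_def)
    then show "(\<Sum>y\<in>range f. norm y * indicator (f -` {y}) x) = norm (f x)"
      using fin by simp
  qed
  finally show ?thesis .
qed

text \<open>
  Each coordinate is rounded down to a multiple of \<open>1 / (m + 1)\<close>; boundedness leaves finitely many values.
\<close>

lemma uniform_simple_approximation:
  fixes f :: "'t::topological_space \<Rightarrow> 'b::euclidean_space"
  assumes "bounded_borel f"
  obtains F where "\<And>m. simple_function borel (F m)" "uniform_limit UNIV F f sequentially"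
proof -
  from assms obtain C where [measurable]: "f \<in> borel_measurable borel" and C: "\<And>x. norm (f x) \<le> C" "C \<ge> 0"
    by (elim bounded_borelE) blast
  define k where "k m x b = \<lfloor>real (Suc m) * (f x \<bullet> b)\<rfloor>" for m x b
  define F where "F m x = (\<Sum>b\<in>Basis. (real_of_int (k m x b) / real (Suc m)) *\<^sub>R b)" for m x
  have "simple_function borel (F m)" for m
  proof (rule simple_function_borel_measurable)
    show "F m \<in> borel_measurable borel"
      unfolding F_def[abs_def] k_def by measurable
    define N where "N = \<lceil>real (Suc m) * C\<rceil> + 1"
    have "k m x b \<in> {- N..N}" if "b \<in> Basis" for x b
    proof -
      have "\<bar>f x \<bullet> b\<bar> \<le> C" using Basis_le_norm[OF that, of "f x"] C(1)[of x] by simp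
      then have "\<bar>real (Suc m) * (f x \<bullet> b)\<bar> \<le> real (Suc m) * C"
        unfolding abs_mult by (intro mult_mono) auto
      then show ?thesis
        unfolding k_def N_def by (simp only: atLeastAtMost_iff) linarith
    qed
    then have "range (F m) \<subseteq> (\<lambda>j. \<Sum>b\<in>Basis. (real_of_int (j b) / real (Suc m)) *\<^sub>R b) ` (Basis \<rightarrow>\<^sub>E {- N..N})"
      by (auto simp: F_def intro!: image_eqI[where x = "restrict (k m _) Basis"] sum.cong)
    then show "finite (F m ` space borel)"
      by (auto intro!: finite_PiE elim!: finite_subset)
  qed
  moreover have "uniform_limit UNIV F f sequentially"
  proof (rule uniform_limitI)
    fix e :: real assume "e > 0"
    have le: "norm (F m x - f x) \<le> real DIM('b) * inverse (real (Suc m))" for m x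
    proof -
      have "F m x - f x = (\<Sum>b\<in>Basis. (real_of_int (k m x b) / real (Suc m) - f x \<bullet> b) *\<^sub>R b)"
        by (simp add: F_def scaleR_diff_left sum_subtractf euclidean_representation)
      also have "norm \<dots> \<le> (\<Sum>b\<in>(Basis :: 'b set). inverse (real (Suc m)))"
      proof (rule sum_norm_le)
        fix b :: 'b assume b: "b \<in> Basis"
        have "\<bar>real_of_int (k m x b) - real (Suc m) * (f x \<bullet> b)\<bar> \<le> 1"
          unfolding k_def by linarith
        then have "\<bar>real_of_int (k m x b) / real (Suc m) - f x \<bullet> b\<bar> \<le> inverse (real (Suc m))"
          by (simp add: field_simps abs_le_iff del: of_nat_Suc)
        then show "norm ((real_of_int (k m x b) / real (Suc m) - f x \<bullet> b) *\<^sub>R b) \<le> inverse (real (Suc m))"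
          using b by simp
      qed
      finally show ?thesis by simp
    qed
    have "(\<lambda>m. real DIM('b) * inverse (real (Suc m))) \<longlonglongrightarrow> real DIM('b) * 0"
      by (intro tendsto_intros LIMSEQ_inverse_real_of_nat)
    then have "eventually (\<lambda>m. real DIM('b) * inverse (real (Suc m)) < e) sequentially"
      using \<open>e > 0\<close> by (intro order_tendstoD(2)) auto
    then show "\<forall>\<^sub>F m in sequentially. \<forall>x\<in>UNIV. dist (F m x) (f x) < e"
      unfolding dist_norm by eventually_elim (blast intro: le_less_trans[OF le])
  qed
  ultimately show ?thesis by (rule that)
qed

text \<open>
  The case \<open>G = F\<close> says that the integrals form a Cauchy sequence, the general case that the limit does
  not depend on the approximating sequence.
\<close>

lemma simple_vint_uniform_limits_merge:
  fixes \<mu> :: "'t::topological_space set \<Rightarrow> 'k::real_or_complex ^ 'n"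
  assumes \<mu>: "\<mu> \<in> cabv"
    and F: "\<And>m. simple_function borel (F m)" "uniform_limit UNIV F f sequentially"
    and G: "\<And>m. simple_function borel (G m)" "uniform_limit UNIV G f sequentially"
    and e: "e > 0"
  obtains N where "\<And>m n. m \<ge> N \<Longrightarrow> n \<ge> N \<Longrightarrow> norm (simple_vint \<mu> (F m) - simple_vint \<mu> (G n)) < e"
proof -
  interpret finite_measure "var_measure \<mu>" by (rule finite_measure_var_measure[OF \<mu>])
  define V where "V = measure (var_measure \<mu>) UNIV"
  \<comment> \<open>the summand 1 covers the case V = 0\<close>
  define \<delta> where "\<delta> = e / (V + 1)"
  have V: "V \<ge> 0" by (simp add: V_def)
  then have \<delta>: "\<delta> > 0" using e by (simp add: \<delta>_def)
  obtain N1 N2 where N1: "\<And>m x. m \<ge> N1 \<Longrightarrow> dist (F m x) (f x) < \<delta> / 2"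
    and N2: "\<And>m x. m \<ge> N2 \<Longrightarrow> dist (G m x) (f x) < \<delta> / 2"
    using uniform_limitD[OF F(2), of "\<delta> / 2"] uniform_limitD[OF G(2), of "\<delta> / 2"] half_gt_zero[OF \<delta>]
    unfolding eventually_sequentially by (metis UNIV_I)
  show ?thesis
  proof (rule that[of "max N1 N2"])
    fix m n assume mn: "m \<ge> max N1 N2" "n \<ge> max N1 N2"
    have le: "norm (F m x + (- 1) *\<^sub>R G n x) \<le> \<delta>" for x
      using N1[of m x] N2[of n x] mn dist_triangle2[of "F m x" "G n x" "f x"]
      by (simp add: dist_norm)
    have s: "simple_function borel (\<lambda>x. F m x + (- 1) *\<^sub>R G n x)"
      using simple_function_diff[OF F(1)[of m] G(1)[of n]] by simp
    have "norm (simple_vint \<mu> (F m) - simple_vint \<mu> (G n)) = norm (simple_vint \<mu> (\<lambda>x. F m x + (- 1) *\<^sub>R G n x))"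
      by (subst simple_vint_lincomb[OF \<mu> F(1) G(1)]) simp
    also have "\<dots> \<le> (\<integral>x. norm (F m x + (- 1) *\<^sub>R G n x) \<partial>var_measure \<mu>)"
      by (rule norm_simple_vint_le[OF \<mu> s])
    also have "\<dots> \<le> (\<integral>x. \<delta> \<partial>var_measure \<mu>)"
      using le by (intro integral_mono integrable_var_measure[OF \<mu> bounded_borel_simple[OF s]]) auto
    also have "\<dots> = \<delta> * V" by (simp add: V_def)
    also have "\<dots> < e"
      using V e by (simp add: \<delta>_def field_simps)
    finally show "norm (simple_vint \<mu> (F m) - simple_vint \<mu> (G n)) < e" .
  qed
qed

text \<open>
  This turns the description of \<open>vint\<close> as the unique limit into a usable limit statement: every uniform
  approximation by simple functions computes the integral. All further properties of \<open>vint\<close> pass to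
  the limit from simple functions.
\<close>

lemma simple_vint_tendsto_vint:
  fixes \<mu> :: "'t::topological_space set \<Rightarrow> 'k::real_or_complex ^ 'n"
  assumes \<mu>: "\<mu> \<in> cabv"
    and F: "\<And>m. simple_function borel (F m)" "uniform_limit UNIV F f sequentially"
  shows "(\<lambda>m. simple_vint \<mu> (F m)) \<longlonglongrightarrow> vint \<mu> f"
proof -
  have "Cauchy (\<lambda>m. simple_vint \<mu> (F m))"
    unfolding Cauchy_def dist_norm by (metis simple_vint_uniform_limits_merge[OF \<mu> F F])
  then obtain I where I: "(\<lambda>m. simple_vint \<mu> (F m)) \<longlonglongrightarrow> I"
    by (auto simp: Cauchy_convergent_iff convergent_def)
  have "J = I" if G: "\<And>m. simple_function borel (G m)" "uniform_limit UNIV G f sequentially"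
    and J: "(\<lambda>m. simple_vint \<mu> (G m)) \<longlonglongrightarrow> J" for G J
  proof -
    have "(\<lambda>m. simple_vint \<mu> (F m) - simple_vint \<mu> (G m)) \<longlonglongrightarrow> 0"
    proof (rule LIMSEQ_I)
      fix e :: real assume "e > 0"
      from simple_vint_uniform_limits_merge[OF \<mu> F G this]
      show "\<exists>N. \<forall>m\<ge>N. norm (simple_vint \<mu> (F m) - simple_vint \<mu> (G m) - 0) < e"
        by (metis diff_zero)
    qed
    then show ?thesis
      using LIMSEQ_unique tendsto_diff[OF I J] by fastforce
  qed
  then have "vint \<mu> f = I"
    unfolding vint_def using F I by (intro the_equality) blast+
  with I show ?thesis by simp
qed

lemma vint_simple:
  assumes "\<mu> \<in> cabv" "simple_function borel f"
  shows "vint \<mu> f = simple_vint \<mu> f"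
  using simple_vint_tendsto_vint[OF assms(1), of "\<lambda>_. f" f] assms(2)
  by (auto simp: LIMSEQ_const_iff uniform_limit_const)

lemma vint_lincomb:
  fixes \<mu> :: "'t::topological_space set \<Rightarrow> 'k::real_or_complex ^ 'n"
  assumes \<mu>: "\<mu> \<in> cabv" and "bounded_borel f" "bounded_borel g"
  shows "vint \<mu> (\<lambda>x. f x + c *\<^sub>R g x) = vint \<mu> f + c *\<^sub>R vint \<mu> g"
proof -
  obtain F G where F: "\<And>m. simple_function borel (F m)" "uniform_limit UNIV F f sequentially"
    and G: "\<And>m. simple_function borel (G m)" "uniform_limit UNIV G g sequentially"
    using uniform_simple_approximation assms(2,3) by metis
  have s: "simple_function borel (\<lambda>x. F m x + c *\<^sub>R G m x)" for m
    using simple_function_add[OF F(1)[of m] simple_function_compose1[OF G(1)[of m]]] by simp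
  have "uniform_limit UNIV (\<lambda>m x. F m x + c *\<^sub>R G m x) (\<lambda>x. f x + c *\<^sub>R g x) sequentially"
    using uniform_limit_add[OF F(2) bounded_linear.uniform_limit[OF bounded_linear_scaleR_right G(2)]] .
  from simple_vint_tendsto_vint[OF \<mu> s this]
  have "(\<lambda>m. simple_vint \<mu> (F m) + c *\<^sub>R simple_vint \<mu> (G m)) \<longlonglongrightarrow> vint \<mu> (\<lambda>x. f x + c *\<^sub>R g x)"
    by (simp add: simple_vint_lincomb[OF \<mu> F(1) G(1)])
  moreover have "(\<lambda>m. simple_vint \<mu> (F m) + c *\<^sub>R simple_vint \<mu> (G m)) \<longlonglongrightarrow> vint \<mu> f + c *\<^sub>R vint \<mu> g"
    by (intro tendsto_intros simple_vint_tendsto_vint \<mu> F G)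
  ultimately show ?thesis by (rule LIMSEQ_unique)
qed

lemma norm_vint_le:
  fixes \<mu> :: "'t::topological_space set \<Rightarrow> 'k::real_or_complex ^ 'n"
  assumes \<mu>: "\<mu> \<in> cabv" and f: "bounded_borel f"
  shows "norm (vint \<mu> f) \<le> (\<integral>x. norm (f x) \<partial>var_measure \<mu>)"
proof -
  interpret finite_measure "var_measure \<mu>" by (rule finite_measure_var_measure[OF \<mu>])
  define V where "V = measure (var_measure \<mu>) UNIV"
  have V: "V \<ge> 0" by (simp add: V_def)
  obtain F where F: "\<And>m. simple_function borel (F m)" "uniform_limit UNIV F f sequentially"
    using uniform_simple_approximation[OF f] by blast
  have bound: "norm (vint \<mu> f) \<le> (\<integral>x. norm (f x) \<partial>var_measure \<mu>) + e * V" if e: "e > 0" for e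
  proof (rule tendsto_upperbound)
    show "(\<lambda>m. norm (simple_vint \<mu> (F m))) \<longlonglongrightarrow> norm (vint \<mu> f)"
      by (intro tendsto_norm simple_vint_tendsto_vint \<mu> F)
    show "\<forall>\<^sub>F m in sequentially. norm (simple_vint \<mu> (F m)) \<le> (\<integral>x. norm (f x) \<partial>var_measure \<mu>) + e * V"
      using uniform_limitD[OF F(2) e]
    proof eventually_elim
      case (elim m)
      have le: "norm (F m x) \<le> norm (f x) + e" for x
        using elim[rule_format, of x] norm_triangle_ineq2[of "F m x" "f x"] by (simp add: dist_norm)
      have "norm (simple_vint \<mu> (F m)) \<le> (\<integral>x. norm (F m x) \<partial>var_measure \<mu>)"
        by (rule norm_simple_vint_le[OF \<mu> F(1)])
      also have "\<dots> \<le> (\<integral>x. norm (f x) + e \<partial>var_measure \<mu>)"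
        using le by (intro integral_mono integrable_var_measure[OF \<mu>] bounded_borel_simple F(1)
            Bochner_Integration.integrable_add f) auto
      also have "\<dots> = (\<integral>x. norm (f x) \<partial>var_measure \<mu>) + e * V"
        by (subst Bochner_Integration.integral_add) (simp_all add: integrable_var_measure[OF \<mu> f] V_def)
      finally show ?case .
    qed
  qed simp
  show ?thesis
  proof (rule field_le_epsilon)
    fix e :: real assume e: "e > 0"
    have "e / (V + 1) * V \<le> e"
      using V e by (simp add: field_simps)
    with bound[of "e / (V + 1)"] V e
    show "norm (vint \<mu> f) \<le> (\<integral>x. norm (f x) \<partial>var_measure \<mu>) + e" by simp
  qed
qed

lemma norm_vint_le_sup:
  fixes \<mu> :: "'t::topological_space set \<Rightarrow> 'k::real_or_complex ^ 'n"
  assumes \<mu>: "\<mu> \<in> cabv" and f: "f \<in> borel_measurable borel" "\<And>x. norm (f x) \<le> c"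
  shows "norm (vint \<mu> f) \<le> c * measure (var_measure \<mu>) UNIV"
proof -
  interpret finite_measure "var_measure \<mu>" by (rule finite_measure_var_measure[OF \<mu>])
  have b: "bounded_borel f" using f by (rule bounded_borelI)
  have "norm (vint \<mu> f) \<le> (\<integral>x. norm (f x) \<partial>var_measure \<mu>)"
    by (rule norm_vint_le[OF \<mu> b])
  also have "\<dots> \<le> (\<integral>x. c \<partial>var_measure \<mu>)"
    by (intro integral_mono integrable_var_measure[OF \<mu> b]) (use f in auto)
  finally show ?thesis by (simp add: mult.commute)
qed

lemma simple_vint_add_measure:
  "simple_vint (\<mu> + \<nu>) f = simple_vint \<mu> f + simple_vint \<nu> f"
  by (simp add: simple_vint_def sprod_add_right sum.distrib)

lemma vint_add_measure:
  fixes \<mu> \<nu> :: "'t::topological_space set \<Rightarrow> 'k::real_or_complex ^ 'n"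
  assumes \<mu>: "\<mu> \<in> cabv" and \<nu>: "\<nu> \<in> cabv" and f: "bounded_borel f"
  shows "vint (\<mu> + \<nu>) f = vint \<mu> f + vint \<nu> f"
proof -
  obtain F where F: "\<And>m. simple_function borel (F m)" "uniform_limit UNIV F f sequentially"
    using uniform_simple_approximation[OF f] by blast
  have "(\<lambda>m. simple_vint (\<mu> + \<nu>) (F m)) \<longlonglongrightarrow> vint \<mu> f + vint \<nu> f"
    unfolding simple_vint_add_measure by (intro tendsto_intros simple_vint_tendsto_vint \<mu> \<nu> F)
  then show ?thesis
    using simple_vint_tendsto_vint[OF cabv_add[OF \<mu> \<nu>] F] LIMSEQ_unique by blast
qed

lemma vint_diff_measure:
  fixes \<mu> \<nu> :: "'t::topological_space set \<Rightarrow> 'k::real_or_complex ^ 'n"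
  assumes \<mu>: "\<mu> \<in> cabv" and \<nu>: "\<nu> \<in> cabv" and f: "bounded_borel f"
  shows "vint (\<mu> - \<nu>) f = vint \<mu> f - vint \<nu> f"
  using vint_add_measure[OF cabv_diff[OF \<mu> \<nu>] \<nu> f] by simp

text \<open>
  Change of variables. For a simple function \<open>F\<close> both sides are sums over values \<open>y\<close> of
  \<open>\<langle>y, R (\<mu> (h -` F -` {y}))\<rangle>\<close>; values that \<open>F\<close> takes only off the range of \<open>h\<close> contribute \<open>0\<close>.
\<close>

lemma vint_op_image:
  fixes \<mu> :: "'t::topological_space set \<Rightarrow> 'k::real_or_complex ^ 'n"
  assumes \<mu>: "\<mu> \<in> cabv" and R: "R \<in> cont_lin_ops" and h: "h \<in> borel_measurable borel"
    and f: "bounded_borel f"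
  shows "vint (op_image R h \<mu>) f = vint \<mu> (\<lambda>x. adj_op R (f (h x)))"
proof -
  have R\<mu>: "op_image R h \<mu> \<in> cabv"
    by (intro cabv_op_image \<mu> h cont_lin_ops_bounded_linear R)
  obtain F where F: "\<And>m. simple_function borel (F m)" "uniform_limit UNIV F f sequentially"
    using uniform_simple_approximation[OF f] by blast
  have Fh: "simple_function borel (\<lambda>x. F m (h x))" for m
  proof (rule simple_function_borel_measurable)
    show "(\<lambda>x. F m (h x)) \<in> borel_measurable borel"
      using measurable_compose[OF h borel_measurable_simple_function[OF F(1)]] .
    show "finite ((\<lambda>x. F m (h x)) ` space borel)"
      using simple_functionD(1)[OF F(1)[of m]] by (rule finite_subset[rotated]) auto
  qed
  have eq: "simple_vint (op_image R h \<mu>) (F m) = simple_vint \<mu> (\<lambda>x. adj_op R (F m (h x)))" for m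
  proof -
    have fin: "finite (range (F m))" and meas: "F m -` {y} \<in> sets borel" for y
      using simple_functionD[OF F(1)[of m]] by auto
    have "simple_vint (op_image R h \<mu>) (F m) = (\<Sum>y\<in>range (F m). sprod (adj_op R y) (\<mu> (h -` (F m -` {y}))))"
      by (simp add: simple_vint_def op_image_def meas sprod_adj_op[OF R])
    also have "\<dots> = (\<Sum>y\<in>range (\<lambda>x. F m (h x)). sprod (adj_op R y) (\<mu> (h -` (F m -` {y}))))"
    proof (rule sum.mono_neutral_right[OF fin])
      show "range (\<lambda>x. F m (h x)) \<subseteq> range (F m)" by auto
      have "h -` (F m -` {y}) = {}" if "y \<notin> range (\<lambda>x. F m (h x))" for y
        using that by auto
      then show "\<forall>y\<in>range (F m) - range (\<lambda>x. F m (h x)). sprod (adj_op R y) (\<mu> (h -` (F m -` {y}))) = 0"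
        by (simp add: cabv_empty[OF \<mu>])
    qed
    also have "\<dots> = simple_vint \<mu> (\<lambda>x. adj_op R (F m (h x)))"
      using simple_vint_compose[OF \<mu> Fh, of "adj_op R"] by (simp add: vimage_def)
    finally show ?thesis .
  qed
  have "uniform_limit UNIV (\<lambda>m x. adj_op R (F m (h x))) (\<lambda>x. adj_op R (f (h x))) sequentially"
    by (intro bounded_linear.uniform_limit[OF bounded_linear_adj_op[OF R]] uniform_limit_compose'[OF F(2)]) auto
  then have "(\<lambda>m. simple_vint \<mu> (\<lambda>x. adj_op R (F m (h x)))) \<longlonglongrightarrow> vint \<mu> (\<lambda>x. adj_op R (f (h x)))"
    by (intro simple_vint_tendsto_vint[OF \<mu>] simple_function_compose1[OF Fh])
  then show ?thesis
    using simple_vint_tendsto_vint[OF R\<mu> F] LIMSEQ_unique unfolding eq by blast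
qed

section \<open>Bounded Lipschitz functions and the Monge-Kantorovich norm\<close>

text \<open>
  Real bounds for the two parts of the bounded Lipschitz norm, so that estimates need not be carried
  out with extended values.
\<close>

definition bl_bound :: "real \<Rightarrow> real \<Rightarrow> ('t::metric_space \<Rightarrow> 'b::real_normed_vector) \<Rightarrow> bool" where
  "bl_bound s l f \<longleftrightarrow> 0 \<le> s \<and> 0 \<le> l \<and> (\<forall>x. norm (f x) \<le> s) \<and> (\<forall>x y. dist (f x) (f y) \<le> l * dist x y)"

lemma Lip_dist_le:
  assumes "f \<in> Lip"
  shows "dist (f x) (f y) \<le> enn2real (lip f) * dist x y"
proof (cases "x = y")
  case False
  have "ennreal (dist (f x) (f y) / dist x y) \<le> lip f"
    unfolding lip_on_def using False by (auto intro!: SUP_upper2[where i = "(x, y)"])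
  also have "\<dots> = ennreal (enn2real (lip f))"
    using assms by (simp add: Lip_def)
  finally have "dist (f x) (f y) / dist x y \<le> enn2real (lip f)"
    by simp
  then show ?thesis using False by (simp add: divide_le_eq)
qed simp

lemma lip_le:
  assumes "\<And>x y. dist (f x) (f y) \<le> l * dist x y"
  shows "lip f \<le> ennreal l"
  unfolding lip_on_def using assms by (auto intro!: SUP_least ennreal_leI simp: divide_le_eq)

lemma Lip_continuous:
  assumes "\<And>x y. dist (f x) (f y) \<le> l * dist x y" "0 \<le> l"
  shows "continuous_on UNIV f"
  by (rule lipschitz_on_continuous_on[of l]) (use assms in \<open>auto simp: lipschitz_on_def\<close>)

lemma Lip_imp_borel_measurable: "f \<in> Lip \<Longrightarrow> f \<in> borel_measurable borel"
  by (intro borel_measurable_continuous_onI Lip_continuous[OF Lip_dist_le]) auto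

lemma Lip_bl_bound:
  assumes "f \<in> Lip" "bl_norm f \<le> 1"
  obtains s l where "bl_bound s l f" "s + l \<le> 1"
proof -
  define S where "S = (SUP x. ennreal (norm (f x)))"
  have le: "S + lip f \<le> 1" using assms(2) by (simp add: bl_norm_def S_def)
  then have fin: "S < \<infinity>" "lip f < \<infinity>"
    by (metis ennreal_one_less_top infinity_ennreal_def le_less_trans le_iff_add add.commute)+
  have "ennreal (norm (f x)) \<le> ennreal (enn2real S)" for x
    using fin by (auto simp: S_def intro!: SUP_upper)
  then have "norm (f x) \<le> enn2real S" for x by simp
  then have "bl_bound (enn2real S) (enn2real (lip f)) f"
    using Lip_dist_le[OF assms(1)] by (simp add: bl_bound_def)
  moreover have "ennreal (enn2real S + enn2real (lip f)) \<le> ennreal 1"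
    using le fin by (simp add: ennreal_plus)
  then have "enn2real S + enn2real (lip f) \<le> 1" by (simp only: ennreal_le_iff zero_le_one)
  ultimately show ?thesis by (rule that)
qed

lemma bl_bound_imp_Lip:
  assumes "bl_bound s l f" "s + l \<le> 1"
  shows "f \<in> Lip" "bl_norm f \<le> 1"
proof -
  have l: "lip f \<le> ennreal l" using assms by (intro lip_le) (auto simp: bl_bound_def)
  then show "f \<in> Lip" by (auto simp: Lip_def intro: le_less_trans)
  have "(SUP x. ennreal (norm (f x))) \<le> ennreal s"
    using assms by (auto intro!: SUP_least simp: bl_bound_def)
  then have "bl_norm f \<le> ennreal s + ennreal l"
    unfolding bl_norm_def using l by (rule add_mono)
  also have "\<dots> = ennreal (s + l)" using assms by (simp add: bl_bound_def)
  also have "\<dots> \<le> 1" using assms by simp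
  finally show "bl_norm f \<le> 1" .
qed

lemma bl_bound_continuous: "bl_bound s l f \<Longrightarrow> continuous_on UNIV f"
  by (rule Lip_continuous[of f l]) (auto simp: bl_bound_def)

lemma bl_bound_measurable: "bl_bound s l f \<Longrightarrow> f \<in> borel_measurable borel"
  by (intro borel_measurable_continuous_onI bl_bound_continuous)

lemma bl_bound_bounded_borel: "bl_bound s l f \<Longrightarrow> bounded_borel f"
  by (rule bounded_borelI[of f s]) (auto simp: bl_bound_def intro: bl_bound_measurable)

lemma bl_bound_scaleR:
  assumes "bl_bound s l f"
  shows "bl_bound (\<bar>c\<bar> * s) (\<bar>c\<bar> * l) (\<lambda>x. c *\<^sub>R f x)"
  using assms by (auto simp: bl_bound_def dist_norm mult.assoc intro!: mult_left_mono
      simp flip: scaleR_diff_right)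

lemma bl_bound_scaleR_const:
  assumes "bl_bound s l (g :: _ \<Rightarrow> real)"
  shows "bl_bound (s * norm v) (l * norm v) (\<lambda>x. g x *\<^sub>R v)"
proof -
  have "dist (g x *\<^sub>R v) (g y *\<^sub>R v) \<le> l * norm v * dist x y" for x y
  proof -
    have "dist (g x *\<^sub>R v) (g y *\<^sub>R v) = dist (g x) (g y) * norm v"
      by (simp add: dist_norm flip: scaleR_diff_left)
    also have "\<dots> \<le> (l * dist x y) * norm v"
      using assms by (intro mult_right_mono) (auto simp: bl_bound_def)
    finally show ?thesis by (simp add: mult_ac)
  qed
  then show ?thesis
    using assms by (auto simp: bl_bound_def mult_right_mono)
qed

lemma bl_bound_add:
  assumes "bl_bound s l f" "bl_bound s' l' g"
  shows "bl_bound (s + s') (l + l') (\<lambda>x. f x + g x)"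
proof -
  have "dist (f x + g x) (f y + g y) \<le> l * dist x y + l' * dist x y" for x y
    using assms dist_triangle_add[of "f x" "g x" "f y" "g y"]
    unfolding bl_bound_def by (smt (verit))
  then show ?thesis
    using assms by (auto simp: bl_bound_def distrib_right intro: norm_triangle_mono)
qed

lemma vint_zero: "\<mu> \<in> cabv \<Longrightarrow> vint \<mu> (\<lambda>_. 0) = 0"
  using norm_vint_le_sup[of \<mu> "\<lambda>_. 0" 0] by simp

lemma vint_scaleR:
  assumes "\<mu> \<in> cabv" "bounded_borel f"
  shows "vint \<mu> (\<lambda>x. c *\<^sub>R f x) = c *\<^sub>R vint \<mu> f"
  using vint_lincomb[OF assms(1) _ assms(2), of "\<lambda>_. 0" c]
  by (simp add: vint_zero[OF assms(1)] bounded_borelI[of _ 0])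

text \<open>
  Homogeneity: \<open>f / (s + l)\<close> is admissible in the supremum. That supremum is taken over the reals, so
  its boundedness has to be established, which the variation of \<open>\<mu>\<close> provides.
\<close>

lemma norm_vint_le_mk_norm:
  fixes \<mu> :: "'t::metric_space set \<Rightarrow> 'k::real_or_complex ^ 'n"
  assumes \<mu>: "\<mu> \<in> cabv" and f: "bl_bound s l f"
  shows "norm (vint \<mu> f) \<le> (s + l) * mk_norm \<mu>"
proof (cases "s + l = 0")
  case True
  then have "f = (\<lambda>_. 0)" using f by (auto simp: bl_bound_def fun_eq_iff add_nonneg_eq_0_iff)
  then show ?thesis using True by (simp add: vint_zero[OF \<mu>])
next
  case False
  define c where "c = s + l"
  have c: "c > 0" using False f by (auto simp: c_def bl_bound_def)
  define g where "g x = inverse c *\<^sub>R f x" for x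
  have g: "bl_bound (inverse c * s) (inverse c * l) g"
    using bl_bound_scaleR[OF f, of "inverse c"] c by (simp add: g_def[abs_def])
  have "inverse c * s + inverse c * l \<le> 1"
    using c by (simp add: c_def flip: distrib_left)
  then have gL: "g \<in> {f \<in> Lip. bl_norm f \<le> 1}" using bl_bound_imp_Lip[OF g] by simp
  have bdd: "bdd_above ((\<lambda>f. norm (vint \<mu> f)) ` {f \<in> Lip. bl_norm f \<le> 1})"
  proof (rule bdd_aboveI2)
    fix f :: "'t \<Rightarrow> 'k ^ 'n" assume "f \<in> {f \<in> Lip. bl_norm f \<le> 1}"
    then obtain s l where f: "bl_bound s l f" "s + l \<le> 1"
      by (auto elim: Lip_bl_bound)
    then have "norm (f x) \<le> 1" for x by (auto simp: bl_bound_def intro: order_trans[of _ s])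
    then show "norm (vint \<mu> f) \<le> 1 * measure (var_measure \<mu>) UNIV"
      by (intro norm_vint_le_sup \<mu> bl_bound_measurable[OF f(1)])
  qed
  have "f = (\<lambda>x. c *\<^sub>R g x)" using c by (simp add: g_def fun_eq_iff)
  then have "norm (vint \<mu> f) = c * norm (vint \<mu> g)"
    using c by (simp add: vint_scaleR[OF \<mu> bl_bound_bounded_borel[OF g]])
  also have "\<dots> \<le> c * mk_norm \<mu>"
    unfolding mk_norm_def using c by (intro mult_left_mono cSUP_upper[OF gL bdd]) auto
  finally show ?thesis by (simp add: c_def)
qed

lemma mk_norm_le:
  fixes \<mu> :: "'t::metric_space set \<Rightarrow> 'k::real_or_complex ^ 'n"
  assumes "\<And>f s l. bl_bound s l f \<Longrightarrow> s + l \<le> 1 \<Longrightarrow> norm (vint \<mu> f) \<le> C"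
  shows "mk_norm \<mu> \<le> C"
  unfolding mk_norm_def
proof (rule cSUP_least)
  have "bl_bound 0 0 (\<lambda>_::'t. 0 :: 'k ^ 'n)" by (simp add: bl_bound_def)
  from bl_bound_imp_Lip[OF this] show "{f :: 't \<Rightarrow> 'k ^ 'n. f \<in> Lip \<and> bl_norm f \<le> 1} \<noteq> {}" by auto
  show "norm (vint \<mu> f) \<le> C" if "f \<in> {f \<in> Lip. bl_norm f \<le> 1}" for f
    using that assms by (auto elim: Lip_bl_bound)
qed

lemma mk_norm_nonneg:
  fixes \<mu> :: "'t::metric_space set \<Rightarrow> 'k::real_or_complex ^ 'n"
  assumes "\<mu> \<in> cabv"
  shows "0 \<le> mk_norm \<mu>"
  using norm_vint_le_mk_norm[OF assms, of 1 0 "\<lambda>_. 0"] by (simp add: bl_bound_def vint_zero[OF assms])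

section \<open>Lipschitz functions are dense in L1\<close>

text \<open>
  As \<open>m\<close> grows, these functions decrease to the indicator of the closure of a nonempty set \<open>C\<close>.
\<close>

lemma bl_bound_infdist_cutoff:
  "bl_bound 1 (real m) (\<lambda>x. max 0 (1 - real m * infdist x C))"
proof -
  have "\<bar>max 0 (1 - real m * infdist x C) - max 0 (1 - real m * infdist y C)\<bar> \<le> real m * dist x y" for x y
  proof -
    have "\<bar>max 0 (1 - real m * infdist x C) - max 0 (1 - real m * infdist y C)\<bar>
        \<le> \<bar>real m * infdist x C - real m * infdist y C\<bar>" by linarith
    also have "\<dots> = real m * \<bar>infdist x C - infdist y C\<bar>"
      by (simp add: abs_mult flip: right_diff_distrib)
    also have "\<dots> \<le> real m * dist x y"
      by (intro mult_left_mono infdist_triangle_abs) auto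
    finally show ?thesis .
  qed
  then show ?thesis by (auto simp: bl_bound_def dist_real_def infdist_nonneg)
qed

text \<open>
  The Borel sets with this property contain the closed sets, by the cutoff functions and dominated
  convergence, and are closed under complements, via \<open>1 - g\<close>, and under countable disjoint unions, where
  finitely many members already carry all but \<open>\<epsilon> / 2\<close> of the mass. The closed sets are stable under
  intersection, so these are all Borel sets.
\<close>

lemma bl_approx_indicator:
  fixes N :: "'t::metric_space measure"
  assumes N: "finite_measure N" and sets: "sets N = sets borel" and B: "B \<in> sets borel"
    and \<epsilon>: "\<epsilon> > 0"
  shows "\<exists>g s l. bl_bound s l (g :: 't \<Rightarrow> real) \<and> (\<integral>x. \<bar>g x - indicator B x\<bar> \<partial>N) < \<epsilon>"
proof -
  interpret finite_measure N by (rule N)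
  note sets[measurable_cong]
  have int: "integrable N (\<lambda>x. \<bar>f x - indicator C x\<bar>)" if "bl_bound s l f" "C \<in> sets borel"
    for f :: "'t \<Rightarrow> real" and s l C
  proof (rule integrable_const_bound[where B = "s + 1"])
    have "\<bar>f x - indicator C x\<bar> \<le> s + 1" for x
      using that(1) by (auto simp: bl_bound_def indicator_def abs_le_iff intro: order_trans[of _ s])
    then show "AE x in N. norm \<bar>f x - indicator C x\<bar> \<le> s + 1" by simp
    show "(\<lambda>x. \<bar>f x - indicator C x\<bar>) \<in> borel_measurable N"
      using bl_bound_measurable[OF that(1)] that(2) by measurable
  qed
  have stable: "Int_stable (Collect closed :: 't set set)"
    by (auto simp: Int_stable_def)
  have Bs: "B \<in> sigma_sets UNIV (Collect closed)"
    using B by (simp add: borel_eq_closed)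
  have "\<forall>\<epsilon>>0. \<exists>g s l. bl_bound s l (g :: 't \<Rightarrow> real) \<and> (\<integral>x. \<bar>g x - indicator B x\<bar> \<partial>N) < \<epsilon>"
    using stable subset_UNIV[of "Collect closed", folded Pow_UNIV] Bs
  proof (induction rule: sigma_sets_induct_disjoint)
    fix C :: "'t set" assume "C \<in> Collect closed"
    then have C: "closed C" by simp
    then have [measurable]: "C \<in> sets borel" by simp
    show "\<forall>\<epsilon>>0. \<exists>g s l. bl_bound s l (g :: 't \<Rightarrow> real) \<and> (\<integral>x. \<bar>g x - indicator C x\<bar> \<partial>N) < \<epsilon>"
    proof (cases "C = {}")
      case True
      then show ?thesis by (intro allI impI exI[of _ "\<lambda>_. 0"] exI[of _ 0]) (simp add: bl_bound_def)
    next
      case False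
      define g where "g m x = max 0 (1 - real m * infdist x C)" for m x
      have g: "bl_bound 1 (real m) (g m)" for m
        unfolding g_def[abs_def] by (rule bl_bound_infdist_cutoff)
      have [measurable]: "g m \<in> borel_measurable borel" for m
        by (rule bl_bound_measurable[OF g])
      have lim: "(\<lambda>m. \<bar>g m x - indicator C x\<bar>) \<longlonglongrightarrow> 0" for x
      proof (cases "x \<in> C")
        case True
        then show ?thesis by (simp add: g_def)
      next
        case x: False
        then have pos: "infdist x C > 0"
          using C False in_closed_iff_infdist_zero infdist_nonneg less_le by metis
        obtain m0 :: nat where m0: "inverse (infdist x C) < real m0"
          using reals_Archimedean2 by blast
        have "g m x = 0" if "m \<ge> m0" for m
        proof -
          have "inverse (infdist x C) \<le> real m" using m0 that by linarith
          then have "1 \<le> real m * infdist x C" using pos by (simp add: field_simps)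
          then show ?thesis by (simp add: g_def)
        qed
        then have "\<forall>\<^sub>F m in sequentially. \<bar>g m x - indicator C x\<bar> = 0"
          using x by (auto simp: eventually_sequentially)
        then show ?thesis by (simp add: tendsto_eventually)
      qed
      have le1: "\<bar>g m x - indicator C x\<bar> \<le> 1" for m x
        by (auto simp: g_def indicator_def infdist_nonneg)
      have "(\<lambda>m. \<integral>x. \<bar>g m x - indicator C x\<bar> \<partial>N) \<longlonglongrightarrow> (\<integral>x. 0 \<partial>N)"
      proof (rule integral_dominated_convergence[where w = "\<lambda>_. 1"])
        show "AE x in N. (\<lambda>m. \<bar>g m x - indicator C x\<bar>) \<longlonglongrightarrow> 0" using lim by simp
        show "AE x in N. norm \<bar>g m x - indicator C x\<bar> \<le> 1" for m using le1 by simp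
      qed simp_all
      then have lim0: "(\<lambda>m. \<integral>x. \<bar>g m x - indicator C x\<bar> \<partial>N) \<longlonglongrightarrow> 0" by simp
      show ?thesis
      proof (intro allI impI)
        fix \<epsilon> :: real assume "\<epsilon> > 0"
        then have "\<forall>\<^sub>F m in sequentially. (\<integral>x. \<bar>g m x - indicator C x\<bar> \<partial>N) < \<epsilon>"
          using lim0 by (intro order_tendstoD(2))
        then obtain m where "(\<integral>x. \<bar>g m x - indicator C x\<bar> \<partial>N) < \<epsilon>"
          by (auto simp: eventually_sequentially)
        then show "\<exists>g s l. bl_bound s l (g :: 't \<Rightarrow> real) \<and> (\<integral>x. \<bar>g x - indicator C x\<bar> \<partial>N) < \<epsilon>"
          using g by blast
      qed
    qed
  next
    show "\<forall>\<epsilon>>0. \<exists>g s l. bl_bound s l (g :: 't \<Rightarrow> real) \<and> (\<integral>x. \<bar>g x - indicator {} x\<bar> \<partial>N) < \<epsilon>"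
      by (intro allI impI exI[of _ "\<lambda>_. 0"] exI[of _ 0]) (simp add: bl_bound_def)
  next
    fix C :: "'t set"
    assume IH: "\<forall>\<epsilon>>0. \<exists>g s l. bl_bound s l (g :: 't \<Rightarrow> real) \<and> (\<integral>x. \<bar>g x - indicator C x\<bar> \<partial>N) < \<epsilon>"
    show "\<forall>\<epsilon>>0. \<exists>g s l. bl_bound s l (g :: 't \<Rightarrow> real) \<and> (\<integral>x. \<bar>g x - indicator (UNIV - C) x\<bar> \<partial>N) < \<epsilon>"
    proof (intro allI impI)
      fix \<epsilon> :: real assume "\<epsilon> > 0"
      with IH obtain g s l where g: "bl_bound s l (g :: 't \<Rightarrow> real)" "(\<integral>x. \<bar>g x - indicator C x\<bar> \<partial>N) < \<epsilon>"
        by blast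
      have "bl_bound 1 0 (\<lambda>_::'t. 1 :: real)" by (simp add: bl_bound_def)
      from bl_bound_add[OF this bl_bound_scaleR[OF g(1), of "- 1"]]
      have "bl_bound (1 + s) l (\<lambda>x. 1 - g x)" by simp
      moreover have "\<bar>(1 - g x) - indicator (UNIV - C) x\<bar> = \<bar>g x - indicator C x\<bar>" for x
        by (auto simp: indicator_def)
      ultimately show "\<exists>g s l. bl_bound s l (g :: 't \<Rightarrow> real) \<and> (\<integral>x. \<bar>g x - indicator (UNIV - C) x\<bar> \<partial>N) < \<epsilon>"
        using g(2) by (intro exI[of _ "\<lambda>x. 1 - g x"]) auto
    qed
  next
    fix A :: "nat \<Rightarrow> 't set"
    assume disj: "disjoint_family A" and A: "range A \<subseteq> sigma_sets UNIV (Collect closed)"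
      and IH: "\<And>i. \<forall>\<epsilon>>0. \<exists>g s l. bl_bound s l (g :: 't \<Rightarrow> real) \<and> (\<integral>x. \<bar>g x - indicator (A i) x\<bar> \<partial>N) < \<epsilon>"
    have Ai [measurable]: "A i \<in> sets borel" for i
      using A by (auto simp: borel_eq_closed)
    define U where "U = (\<Union>i. A i)"
    have [measurable]: "U \<in> sets borel" by (simp add: U_def)
    have "(\<lambda>n. \<integral>x. \<bar>indicat_real (\<Union>i<n. A i) x - indicator U x\<bar> \<partial>N) \<longlonglongrightarrow> (\<integral>x. 0 \<partial>N)"
    proof (rule integral_dominated_convergence[where w = "\<lambda>_. 1 :: real"])
      have "(\<lambda>n. \<bar>indicat_real (\<Union>i<n. A i) x - indicator U x\<bar>) \<longlonglongrightarrow> (0::real)" for x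
        using tendsto_rabs[OF LIM_zero[OF LIMSEQ_indicator_UN[of A x]]] by (simp add: U_def)
      then show "AE x in N. (\<lambda>n. \<bar>indicat_real (\<Union>i<n. A i) x - indicator U x\<bar>) \<longlonglongrightarrow> (0::real)" by simp
      show "AE x in N. norm \<bar>indicat_real (\<Union>i<n. A i) x - indicator U x :: real\<bar> \<le> 1" for n
        by (simp add: indicator_def)
    qed auto
    then have lim0: "(\<lambda>n. \<integral>x. \<bar>indicat_real (\<Union>i<n. A i) x - indicator U x\<bar> \<partial>N) \<longlonglongrightarrow> 0" by simp
    show "\<forall>\<epsilon>>0. \<exists>g s l. bl_bound s l (g :: 't \<Rightarrow> real) \<and> (\<integral>x. \<bar>g x - indicator (\<Union>i. A i) x\<bar> \<partial>N) < \<epsilon>"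
    proof (intro allI impI)
      fix \<epsilon> :: real assume \<epsilon>: "\<epsilon> > 0"
      then have "\<forall>\<^sub>F n in sequentially. (\<integral>x. \<bar>indicat_real (\<Union>i<n. A i) x - indicator U x\<bar> \<partial>N) < \<epsilon> / 2"
        using lim0 by (intro order_tendstoD(2)) auto
      then obtain n where n: "(\<integral>x. \<bar>indicat_real (\<Union>i<n. A i) x - indicator U x\<bar> \<partial>N) < \<epsilon> / 2"
        by (auto simp: eventually_sequentially)
      define \<delta> where "\<delta> = \<epsilon> / (2 * (real n + 1))"
      have "\<delta> > 0" using \<epsilon> by (simp add: \<delta>_def)
      then have "\<forall>i. \<exists>g. (\<exists>s l. bl_bound s l (g :: 't \<Rightarrow> real)) \<and> (\<integral>x. \<bar>g x - indicator (A i) x\<bar> \<partial>N) < \<delta>"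
        using IH by blast
      then obtain g where g: "\<And>i. \<exists>s l. bl_bound s l (g i :: 't \<Rightarrow> real)"
        and g\<delta>: "\<And>i. (\<integral>x. \<bar>g i x - indicator (A i) x\<bar> \<partial>N) < \<delta>"
        by metis
      have ex: "\<exists>s l. bl_bound s l (\<lambda>x. \<Sum>i<n. g i x)"
      proof (induction n)
        case 0
        then show ?case by (intro exI[of _ 0]) (simp add: bl_bound_def)
      next
        case (Suc n)
        with g[of n] show ?case by (auto dest: bl_bound_add)
      qed
      then obtain s l where sl: "bl_bound s l (\<lambda>x. \<Sum>i<n. g i x)" by blast
      have int_i: "integrable N (\<lambda>x. \<bar>g i x - indicator (A i) x\<bar>)" for i
        using g[of i] int[of _ _ "g i" "A i"] Ai by blast
      have int_n: "integrable N (\<lambda>x. \<bar>indicat_real (\<Union>i<n. A i) x - indicator U x :: real\<bar>)"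
        by (rule integrable_const_bound[where B = 1]) (auto simp: indicator_def)
      have "(\<integral>x. \<bar>(\<Sum>i<n. g i x) - indicator U x\<bar> \<partial>N)
         \<le> (\<integral>x. (\<Sum>i<n. \<bar>g i x - indicator (A i) x\<bar>) + \<bar>indicat_real (\<Union>i<n. A i) x - indicator U x\<bar> \<partial>N)"
      proof (rule integral_mono)
        fix x
        have "indicat_real (\<Union>i<n. A i) x = (\<Sum>i<n. indicator (A i) x :: real)"
          using disj by (intro indicator_UN_disjoint) (auto intro: disjoint_family_on_mono)
        then have "(\<Sum>i<n. g i x) - indicator U x =
            (\<Sum>i<n. g i x - indicator (A i) x) + (indicat_real (\<Union>i<n. A i) x - indicator U x)"
          by (simp add: sum_subtractf)
        then show "\<bar>(\<Sum>i<n. g i x) - indicator U x\<bar>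
          \<le> (\<Sum>i<n. \<bar>g i x - indicator (A i) x\<bar>) + \<bar>indicat_real (\<Union>i<n. A i) x - indicator U x\<bar>"
          using sum_abs[of "\<lambda>i. g i x - indicator (A i) x" "{..<n}"] by linarith
      qed (auto intro!: int[OF sl] int_i int_n)
      also have "\<dots> = (\<Sum>i<n. \<integral>x. \<bar>g i x - indicator (A i) x\<bar> \<partial>N) + (\<integral>x. \<bar>indicat_real (\<Union>i<n. A i) x - indicator U x\<bar> \<partial>N)"
        using int_i int_n by (simp add: Bochner_Integration.integral_add Bochner_Integration.integral_sum)
      also have "\<dots> < real n * \<delta> + \<epsilon> / 2"
        using sum_mono[of "{..<n}" "\<lambda>i. \<integral>x. \<bar>g i x - indicator (A i) x\<bar> \<partial>N" "\<lambda>_. \<delta>"] g\<delta> n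
        by (intro add_le_less_mono) (auto intro: less_imp_le)
      also have "real n * \<delta> \<le> \<epsilon> / 2"
        using \<epsilon> by (simp add: \<delta>_def field_simps)
      finally show "\<exists>g s l. bl_bound s l (g :: 't \<Rightarrow> real) \<and> (\<integral>x. \<bar>g x - indicator (\<Union>i. A i) x\<bar> \<partial>N) < \<epsilon>"
        using sl unfolding U_def by (intro exI[of _ "\<lambda>x. \<Sum>i<n. g i x"]) auto
    qed
  qed
  then show ?thesis using \<epsilon> by blast
qed

lemma bounded_borel_indicator:
  "B \<in> sets borel \<Longrightarrow> bounded_borel (\<lambda>x. indicator B x *\<^sub>R v)"
  by (rule bounded_borelI[where C = "norm v"]) (auto simp: indicator_def)

lemma vint_indicator:
  fixes \<mu> :: "'t::topological_space set \<Rightarrow> 'k::real_or_complex ^ 'n"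
  assumes \<mu>: "\<mu> \<in> cabv" and B: "B \<in> sets borel"
  shows "vint \<mu> (\<lambda>x. indicator B x *\<^sub>R v) = sprod v (\<mu> B)"
proof -
  let ?g = "\<lambda>x. x \<in> B"
  have eq: "?g -` {b} = (if b then B else - B)" for b by auto
  have g: "simple_function borel ?g"
    unfolding simple_function_def using B by (auto simp: eq)
  have "simple_function borel (\<lambda>x. (if x \<in> B then v else 0))"
    using simple_function_compose1[OF g, of "\<lambda>b. if b then v else 0"] .
  then have "vint \<mu> (\<lambda>x. (if x \<in> B then v else 0)) = simple_vint \<mu> (\<lambda>x. (if x \<in> B then v else 0))"
    by (rule vint_simple[OF \<mu>])
  also have "\<dots> = (\<Sum>b\<in>range ?g. sprod (if b then v else 0) (\<mu> (?g -` {b})))"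
    using simple_vint_compose[OF \<mu> g, of "\<lambda>b. if b then v else 0"] .
  also have "\<dots> = (\<Sum>b\<in>UNIV. sprod (if b then v else 0) (\<mu> (?g -` {b})))"
  proof (rule sum.mono_neutral_left)
    have "?g -` {b} = {}" if "b \<notin> range ?g" for b using that by auto
    then show "\<forall>b\<in>UNIV - range ?g. sprod (if b then v else 0) (\<mu> (?g -` {b})) = 0"
      by (simp add: cabv_empty[OF \<mu>])
  qed auto
  also have "\<dots> = sprod v (\<mu> B)" by (simp add: UNIV_bool eq)
  also have "(\<lambda>x. (if x \<in> B then v else 0)) = (\<lambda>x. indicator B x *\<^sub>R v)"
    by (auto simp: indicator_def)
  finally show ?thesis .
qed

text \<open>
  All bounded Lipschitz functions have integral \<open>0\<close>. Approximating the indicator of \<open>B\<close> by such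
  functions in \<open>L\<^sup>1(\<bar>\<mu>\<bar>)\<close> gives \<open>\<langle>v, \<mu>(B)\<rangle> = 0\<close> for each vector \<open>v\<close>; the choice \<open>v = \<mu>(B)\<close> shows
  \<open>\<mu>(B) = 0\<close>.
\<close>

lemma mk_norm_eq_0_imp:
  fixes \<mu> :: "'t::metric_space set \<Rightarrow> 'k::real_or_complex ^ 'n"
  assumes \<mu>: "\<mu> \<in> cabv" and mk: "mk_norm \<mu> = 0"
  shows "\<mu> = 0"
proof
  fix B
  show "\<mu> B = 0 B"
  proof (cases "B \<in> sets borel")
    case False
    then show ?thesis by (simp add: cabv_nonborel[OF \<mu>])
  next
    case B: True
    define v where "v = \<mu> B"
    have "norm (sprod v (\<mu> B)) \<le> 0"
    proof (rule field_le_epsilon)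
      fix e :: real assume e: "e > 0"
      define \<epsilon> where "\<epsilon> = e / (norm v + 1)"
      have nv: "norm v + 1 > 0" by (simp add: add_nonneg_pos)
      then have "\<epsilon> > 0" using e by (simp add: \<epsilon>_def)
      then obtain g s l where g: "bl_bound s l (g :: 't \<Rightarrow> real)"
        and g\<epsilon>: "(\<integral>x. \<bar>g x - indicator B x\<bar> \<partial>var_measure \<mu>) < \<epsilon>"
        using bl_approx_indicator[OF finite_measure_var_measure[OF \<mu>] sets_var_measure B] by blast
      have gv: "bl_bound (s * norm v) (l * norm v) (\<lambda>x. g x *\<^sub>R v)"
        by (rule bl_bound_scaleR_const[OF g])
      have "norm (vint \<mu> (\<lambda>x. g x *\<^sub>R v)) \<le> 0"
        using norm_vint_le_mk_norm[OF \<mu> gv] mk by simp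
      then have g0: "vint \<mu> (\<lambda>x. g x *\<^sub>R v) = 0" by simp
      note bi = bounded_borel_indicator[OF B, of v] and bg = bl_bound_bounded_borel[OF gv]
      have "vint \<mu> (\<lambda>x. indicator B x *\<^sub>R v + (- 1) *\<^sub>R (g x *\<^sub>R v)) = sprod v (\<mu> B)"
        unfolding vint_lincomb[OF \<mu> bi bg] vint_indicator[OF \<mu> B] g0 by simp
      then have "norm (sprod v (\<mu> B)) = norm (vint \<mu> (\<lambda>x. indicator B x *\<^sub>R v + (- 1) *\<^sub>R (g x *\<^sub>R v)))"
        by (rule arg_cong[OF sym])
      also have "\<dots> \<le> (\<integral>x. norm (indicator B x *\<^sub>R v + (- 1) *\<^sub>R (g x *\<^sub>R v)) \<partial>var_measure \<mu>)"
        by (rule norm_vint_le[OF \<mu> bounded_borel_lincomb[OF bi bg]])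
      also have "\<dots> = (\<integral>x. \<bar>g x - indicator B x\<bar> * norm v \<partial>var_measure \<mu>)"
      proof (rule Bochner_Integration.integral_cong[OF refl])
        fix x
        have "norm (indicator B x *\<^sub>R v + (- 1) *\<^sub>R (g x *\<^sub>R v)) = norm ((indicator B x - g x) *\<^sub>R v)"
          by (simp add: scaleR_diff_left)
        then show "norm (indicator B x *\<^sub>R v + (- 1) *\<^sub>R (g x *\<^sub>R v)) = \<bar>g x - indicator B x\<bar> * norm v"
          by (simp add: abs_minus_commute)
      qed
      also have "\<dots> = (\<integral>x. \<bar>g x - indicator B x\<bar> \<partial>var_measure \<mu>) * norm v" by simp
      also have "\<dots> \<le> \<epsilon> * norm v" using g\<epsilon> by (intro mult_right_mono) auto
      also have "\<dots> \<le> e" using e nv by (simp add: \<epsilon>_def field_simps)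
      finally show "norm (sprod v (\<mu> B)) \<le> 0 + e" by simp
    qed
    then show ?thesis by (simp add: v_def sprod_self)
  qed
qed

lemma Metric_space_mk_dist:
  fixes A :: "('t::metric_space set \<Rightarrow> 'k::real_or_complex ^ 'n) set"
  assumes A: "A \<subseteq> cabv"
  shows "Metric_space A mk_dist"
proof
  have vd: "vint (\<mu> - \<nu>) f = vint \<mu> f - vint \<nu> f" if "\<mu> \<in> cabv" "\<nu> \<in> cabv" "bl_bound s l f"
    for \<mu> \<nu> :: "'t set \<Rightarrow> 'k ^ 'n" and f s l
    using that by (intro vint_diff_measure bl_bound_bounded_borel)
  show "0 \<le> mk_dist \<mu> \<nu>" for \<mu> \<nu> :: "'t set \<Rightarrow> 'k ^ 'n"
    by (simp add: mk_dist_def mk_norm_nonneg cabv_diff)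
  have le: "mk_norm (\<mu> - \<nu>) \<le> mk_norm (\<nu> - \<mu>)" if "\<mu> \<in> cabv" "\<nu> \<in> cabv" for \<mu> \<nu> :: "'t set \<Rightarrow> 'k ^ 'n"
  proof (rule mk_norm_le)
    fix f s l assume f: "bl_bound s l (f :: 't \<Rightarrow> 'k ^ 'n)" "s + l \<le> 1"
    have "norm (vint (\<mu> - \<nu>) f) = norm (vint (\<nu> - \<mu>) f)"
      by (simp add: vd[OF _ _ f(1)] that norm_minus_commute)
    also have "\<dots> \<le> (s + l) * mk_norm (\<nu> - \<mu>)"
      using f that by (intro norm_vint_le_mk_norm cabv_diff)
    also have "\<dots> \<le> 1 * mk_norm (\<nu> - \<mu>)"
      using f that by (intro mult_right_mono mk_norm_nonneg cabv_diff)
    finally show "norm (vint (\<mu> - \<nu>) f) \<le> mk_norm (\<nu> - \<mu>)" by simp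
  qed
  show "mk_dist \<mu> \<nu> = mk_dist \<nu> \<mu>" for \<mu> \<nu> :: "'t set \<Rightarrow> 'k ^ 'n"
    using le by (auto simp: mk_dist_def intro!: antisym)
  have mk0: "mk_norm (0 :: 't set \<Rightarrow> 'k ^ 'n) = 0"
  proof (rule antisym[OF mk_norm_le mk_norm_nonneg[OF cabv_0]])
    fix f s l assume f: "bl_bound s l (f :: 't \<Rightarrow> 'k ^ 'n)"
    show "norm (vint 0 f) \<le> 0"
      using vd[OF cabv_0 cabv_0 f] by simp
  qed
  show "mk_dist \<mu> \<nu> = 0 \<longleftrightarrow> \<mu> = \<nu>" if "\<mu> \<in> A" "\<nu> \<in> A" for \<mu> \<nu>
    using that A mk_norm_eq_0_imp[OF cabv_diff[of \<mu> \<nu>]] mk0 by (auto simp: mk_dist_def subset_iff)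
  show "mk_dist \<mu> \<rho> \<le> mk_dist \<mu> \<nu> + mk_dist \<nu> \<rho>" if "\<mu> \<in> A" "\<nu> \<in> A" "\<rho> \<in> A" for \<mu> \<nu> \<rho>
  proof -
    have c: "\<mu> \<in> cabv" "\<nu> \<in> cabv" "\<rho> \<in> cabv" using that A by auto
    have "mk_norm (\<mu> - \<rho>) \<le> mk_norm (\<mu> - \<nu>) + mk_norm (\<nu> - \<rho>)"
    proof (rule mk_norm_le)
      fix f s l assume f: "bl_bound s l (f :: 't \<Rightarrow> 'k ^ 'n)" "s + l \<le> 1"
      have "norm (vint (\<mu> - \<rho>) f) = norm (vint (\<mu> - \<nu>) f + vint (\<nu> - \<rho>) f)"
        by (simp add: vd[OF _ _ f(1)] c)
      also have "\<dots> \<le> norm (vint (\<mu> - \<nu>) f) + norm (vint (\<nu> - \<rho>) f)" by (rule norm_triangle_ineq)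
      also have "\<dots> \<le> (s + l) * mk_norm (\<mu> - \<nu>) + (s + l) * mk_norm (\<nu> - \<rho>)"
        using f c by (intro add_mono norm_vint_le_mk_norm cabv_diff)
      also have "\<dots> \<le> 1 * mk_norm (\<mu> - \<nu>) + 1 * mk_norm (\<nu> - \<rho>)"
        using f c by (intro add_mono mult_right_mono mk_norm_nonneg cabv_diff)
      finally show "norm (vint (\<mu> - \<rho>) f) \<le> mk_norm (\<mu> - \<nu>) + mk_norm (\<nu> - \<rho>)" by simp
    qed
    then show ?thesis using c by (simp add: mk_dist_def)
  qed
qed

section \<open>The weak* topology and the variation\<close>

lemma openin_weak_star_basic:
  assumes "continuous_on UNIV f" "open U"
  shows "openin weak_star {\<mu> \<in> cabv. vint \<mu> f \<in> U}"
  unfolding weak_star_def openin_topology_generated_by_iff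
  using assms by (intro generate_topology_on.Basis) blast

lemma topspace_weak_star [simp]: "topspace weak_star = cabv"
proof -
  have "{\<mu> \<in> cabv. vint \<mu> (\<lambda>_. 0) \<in> UNIV} \<in> {{\<mu> \<in> cabv. vint \<mu> f \<in> U} | f U. continuous_on UNIV f \<and> open U}"
    using continuous_on_const open_UNIV by blast
  then show ?thesis
    unfolding weak_star_def topology_generated_by_topspace by auto
qed

lemma vint_sum:
  fixes \<mu> :: "'t::topological_space set \<Rightarrow> 'k::real_or_complex ^ 'n"
  assumes \<mu>: "\<mu> \<in> cabv" and "finite I" "\<And>i. i \<in> I \<Longrightarrow> bounded_borel (f i)"
  shows "bounded_borel (\<lambda>x. \<Sum>i\<in>I. f i x) \<and> vint \<mu> (\<lambda>x. \<Sum>i\<in>I. f i x) = (\<Sum>i\<in>I. vint \<mu> (f i))"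
  using assms(2,3)
proof (induction I)
  case empty
  then show ?case by (simp add: vint_zero[OF \<mu>] bounded_borelI[of _ 0])
next
  case (insert i I)
  have b: "bounded_borel (f i)" "bounded_borel (\<lambda>x. \<Sum>i\<in>I. f i x)" using insert by auto
  show ?case
    using vint_lincomb[OF \<mu> b, of 1] bounded_borel_lincomb[OF b, of 1] insert by simp
qed

text \<open>
  The half of the identity \<open>\<parallel>\<mu>\<parallel> = sup {\<bar>\<integral> f d\<mu>\<bar> : f continuous, \<parallel>f\<parallel> \<le> 1}\<close> that needs an argument. A partition
  \<open>P\<close> almost attaining the variation yields the step function \<open>f\<close> with value \<open>sgn (\<mu> A)\<close> on \<open>A\<close>, whose
  integral is \<open>\<Sum>A\<in>P. \<parallel>\<mu> A\<parallel>\<close>. It is approximated in \<open>L\<^sup>1(\<bar>\<mu>\<bar>)\<close> by a continuous \<open>h\<close>. Composing \<open>h\<close> with the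
  nearest point projection onto the unit ball restores the norm bound and does not spoil the
  approximation: the projection is nonexpansive and fixes the values of \<open>f\<close>.
\<close>

lemma continuous_function_detecting_variation:
  fixes \<mu> :: "'t::metric_space set \<Rightarrow> 'k::real_or_complex ^ 'n"
  assumes \<mu>: "\<mu> \<in> cabv" and a: "0 \<le> a" "ennreal a < variation \<mu>"
  obtains f where "continuous_on UNIV f" "\<And>x. norm (f x) \<le> 1" "a < norm (vint \<mu> f)"
proof -
  obtain P where P: "finite P" "partition_on UNIV P" "P \<subseteq> sets borel"
    and aP: "ennreal a < (\<Sum>A\<in>P. ennreal (norm (\<mu> A)))"
    using a(2) unfolding variation_def less_SUP_iff by blast
  define S where "S = (\<Sum>A\<in>P. norm (\<mu> A))"
  have aS: "a < S" using aP a(1) by (simp add: S_def sum_ennreal ennreal_less_iff)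
  define \<delta> where "\<delta> = (S - a) / (real (card P) + 1)"
  have \<delta>: "\<delta> > 0" using aS by (simp add: \<delta>_def)
  have PB: "A \<in> sets borel" if "A \<in> P" for A using P(3) that by auto
  have "\<forall>A\<in>P. \<exists>g. (\<exists>s l. bl_bound s l (g :: 't \<Rightarrow> real)) \<and> (\<integral>x. \<bar>g x - indicator A x\<bar> \<partial>var_measure \<mu>) < \<delta>"
    using bl_approx_indicator[OF finite_measure_var_measure[OF \<mu>] sets_var_measure PB \<delta>] by blast
  then obtain g where "\<forall>A\<in>P. (\<exists>s l. bl_bound s l (g A :: 't \<Rightarrow> real)) \<and> (\<integral>x. \<bar>g A x - indicator A x\<bar> \<partial>var_measure \<mu>) < \<delta>"
    by metis
  then have g: "\<And>A. A \<in> P \<Longrightarrow> \<exists>s l. bl_bound s l (g A)"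
    and g\<delta>: "\<And>A. A \<in> P \<Longrightarrow> (\<integral>x. \<bar>g A x - indicator A x\<bar> \<partial>var_measure \<mu>) < \<delta>" by blast+
  have gc: "continuous_on UNIV (g A)" if "A \<in> P" for A using g[OF that] bl_bound_continuous by blast
  have gb: "bounded_borel (g A)" if "A \<in> P" for A using g[OF that] bl_bound_bounded_borel by blast
  have ib: "bounded_borel (\<lambda>x. indicat_real A x)" if "A \<in> P" for A
    using PB[OF that] by (intro bounded_borelI[where C = 1]) (auto simp: indicator_def)
  define v where "v A = sgn (\<mu> A)" for A
  have v1: "norm (v A) \<le> 1" for A by (simp add: v_def norm_sgn)
  define f where "f x = (\<Sum>A\<in>P. indicat_real A x *\<^sub>R v A)" for x
  define h where "h x = (\<Sum>A\<in>P. g A x *\<^sub>R v A)" for x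
  define k where "k x = closest_point (cball 0 1) (h x)" for x
  have vf: "bounded_borel f" "vint \<mu> f = S *\<^sub>R 1"
  proof -
    have sum: "bounded_borel f \<and> vint \<mu> f = (\<Sum>A\<in>P. vint \<mu> (\<lambda>x. indicat_real A x *\<^sub>R v A))"
      unfolding f_def[abs_def] by (intro vint_sum[OF \<mu> P(1)] bounded_borel_indicator PB)
    then show "bounded_borel f" by blast
    have "vint \<mu> f = (\<Sum>A\<in>P. vint \<mu> (\<lambda>x. indicat_real A x *\<^sub>R v A))"
      using sum by blast
    also have "\<dots> = (\<Sum>A\<in>P. sprod (v A) (\<mu> A))"
      by (intro sum.cong refl vint_indicator \<mu> PB)
    also have "\<dots> = (\<Sum>A\<in>P. norm (\<mu> A) *\<^sub>R 1)"
    proof (rule sum.cong[OF refl])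
      show "sprod (v A) (\<mu> A) = norm (\<mu> A) *\<^sub>R 1" for A
        by (cases "\<mu> A = 0") (simp_all add: v_def sgn_div_norm sprod_scaleR_left sprod_self power2_eq_square)
    qed
    finally show "vint \<mu> f = S *\<^sub>R 1" by (simp add: S_def scaleR_left.sum)
  qed
  have f1: "norm (f x) \<le> 1" for x
  proof -
    have "norm (f x) \<le> (\<Sum>A\<in>P. indicat_real A x)"
      unfolding f_def
    proof (rule sum_norm_le)
      show "norm (indicat_real A x *\<^sub>R v A) \<le> indicat_real A x" for A
        using v1[of A] by (simp add: indicator_def)
    qed
    also have "\<dots> = indicat_real (\<Union>A\<in>P. A) x"
      using P by (intro indicator_UN_disjoint[symmetric])
        (auto simp: partition_on_def disjoint_def disjoint_family_on_def)
    also have "\<dots> \<le> 1" by (simp add: indicator_def)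
    finally show ?thesis .
  qed
  have kc: "continuous_on UNIV k"
  proof -
    have "continuous_on UNIV h"
      unfolding h_def[abs_def] by (intro continuous_intros gc)
    moreover have "continuous_on UNIV (closest_point (cball (0::'k ^ 'n) 1))"
      by (rule continuous_on_closest_point) auto
    ultimately show ?thesis
      unfolding k_def[abs_def] by (auto intro: continuous_on_compose2)
  qed
  have k1: "norm (k x) \<le> 1" for x
    using closest_point_in_set[of "cball (0::'k ^ 'n) 1" "h x"] by (simp add: k_def)
  have kb: "bounded_borel k"
    by (rule bounded_borelI[OF borel_measurable_continuous_onI[OF kc] k1])
  have kf: "norm (f x + (- 1) *\<^sub>R k x) \<le> (\<Sum>A\<in>P. \<bar>g A x - indicator A x\<bar>)" for x
  proof -
    have "norm (f x + (- 1) *\<^sub>R k x) = dist (closest_point (cball 0 1) (h x)) (closest_point (cball 0 1) (f x))"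
      using f1[of x] by (simp add: k_def closest_point_self dist_norm norm_minus_commute)
    also have "\<dots> \<le> dist (h x) (f x)"
      by (rule closest_point_lipschitz) auto
    also have "\<dots> = norm (\<Sum>A\<in>P. (g A x - indicator A x) *\<^sub>R v A)"
      by (simp add: dist_norm h_def f_def scaleR_diff_left sum_subtractf)
    also have "\<dots> \<le> (\<Sum>A\<in>P. \<bar>g A x - indicator A x\<bar>)"
      using v1 by (intro sum_norm_le) (simp add: mult_left_le)
    finally show ?thesis .
  qed
  have ii: "integrable (var_measure \<mu>) (\<lambda>x. \<bar>g A x - indicator A x\<bar>)" if "A \<in> P" for A
    using integrable_var_measure[OF \<mu> bounded_borel_lincomb[OF gb ib], OF that that, of "- 1"] by simp
  have "S - norm (vint \<mu> k) \<le> norm (vint \<mu> f + (- 1) *\<^sub>R vint \<mu> k)"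
    using norm_triangle_ineq2[of "vint \<mu> f" "vint \<mu> k"] vf(2) a(1) aS by simp
  also have "\<dots> = norm (vint \<mu> (\<lambda>x. f x + (- 1) *\<^sub>R k x))"
    by (simp only: vint_lincomb[OF \<mu> vf(1) kb])
  also have "\<dots> \<le> (\<integral>x. norm (f x + (- 1) *\<^sub>R k x) \<partial>var_measure \<mu>)"
    by (rule norm_vint_le[OF \<mu> bounded_borel_lincomb[OF vf(1) kb]])
  also have "\<dots> \<le> (\<integral>x. (\<Sum>A\<in>P. \<bar>g A x - indicator A x\<bar>) \<partial>var_measure \<mu>)"
    by (rule integral_mono[OF integrable_var_measure[OF \<mu> bounded_borel_lincomb[OF vf(1) kb]] _ kf])
      (rule Bochner_Integration.integrable_sum[OF ii])
  also have "\<dots> = (\<Sum>A\<in>P. \<integral>x. \<bar>g A x - indicator A x\<bar> \<partial>var_measure \<mu>)"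
    by (rule Bochner_Integration.integral_sum[OF ii])
  also have "\<dots> \<le> (\<Sum>A\<in>P. \<delta>)"
    using g\<delta> by (intro sum_mono less_imp_le)
  also have "\<dots> < S - a"
    using aS by (simp add: \<delta>_def field_simps)
  finally have "a < norm (vint \<mu> k)" by simp
  with kc k1 show ?thesis by (rule that)
qed

lemma norm_vint_le_variation:
  fixes \<mu> :: "'t::topological_space set \<Rightarrow> 'k::real_or_complex ^ 'n"
  assumes \<mu>: "\<mu> \<in> cabv" and f: "f \<in> borel_measurable borel" "\<And>x. norm (f x) \<le> c" and c: "0 \<le> c"
    and a: "variation \<mu> \<le> ennreal a" "0 \<le> a"
  shows "norm (vint \<mu> f) \<le> c * a"
proof -
  have "measure (var_measure \<mu>) UNIV \<le> a"
    using a ennreal_measure_var_measure_UNIV[OF \<mu>] by (metis ennreal_le_iff)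
  then show ?thesis
    using norm_vint_le_sup[OF \<mu> f] mult_left_mono[OF _ c] by (meson order_trans)
qed

text \<open>
  The complement of the ball is a union of subbasic open sets, one for each continuous function bounded
  by \<open>1\<close>.
\<close>

lemma closedin_weak_star_cabv_ball:
  assumes a: "0 < a"
  shows "closedin weak_star (cabv_ball a :: ('t::metric_space set \<Rightarrow> 'k::real_or_complex ^ 'n) set)"
  unfolding closedin_def
proof
  show "(cabv_ball a :: ('t set \<Rightarrow> 'k ^ 'n) set) \<subseteq> topspace weak_star"
    by (auto simp: cabv_ball_def)
  define F :: "('t \<Rightarrow> 'k ^ 'n) set" where "F = {f. continuous_on UNIV f \<and> (\<forall>x. norm (f x) \<le> 1)}"
  have "topspace weak_star - cabv_ball a = (\<Union>f\<in>F. {\<mu> \<in> cabv. vint \<mu> f \<in> - cball 0 a})"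
  proof (intro equalityI subsetI)
    fix \<mu> :: "'t set \<Rightarrow> 'k ^ 'n"
    assume "\<mu> \<in> topspace weak_star - cabv_ball a"
    then have \<mu>: "\<mu> \<in> cabv" "ennreal a < variation \<mu>" by (auto simp: cabv_ball_def not_le)
    obtain f where "continuous_on UNIV f" "\<And>x. norm (f x) \<le> 1" "a < norm (vint \<mu> f)"
      using continuous_function_detecting_variation[OF \<mu>(1) less_imp_le[OF a] \<mu>(2)] by blast
    then show "\<mu> \<in> (\<Union>f\<in>F. {\<mu> \<in> cabv. vint \<mu> f \<in> - cball 0 a})"
      using \<mu>(1) by (auto simp: F_def)
  next
    fix \<mu> :: "'t set \<Rightarrow> 'k ^ 'n"
    assume "\<mu> \<in> (\<Union>f\<in>F. {\<mu> \<in> cabv. vint \<mu> f \<in> - cball 0 a})"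
    then obtain f where \<mu>: "\<mu> \<in> cabv" and f: "continuous_on UNIV f" "\<And>x. norm (f x) \<le> 1"
      and gt: "a < norm (vint \<mu> f)" by (auto simp: F_def)
    have "\<not> variation \<mu> \<le> ennreal a"
      using norm_vint_le_variation[OF \<mu> borel_measurable_continuous_onI[OF f(1)] f(2), of a] gt a by auto
    then show "\<mu> \<in> topspace weak_star - cabv_ball a"
      using \<mu> by (simp add: cabv_ball_def)
  qed
  also have "openin weak_star \<dots>"
  proof (rule openin_Union)
    fix S assume "S \<in> (\<lambda>f. {\<mu> \<in> cabv. vint \<mu> f \<in> - cball 0 a}) ` F"
    then obtain f where "continuous_on UNIV f" "S = {\<mu> \<in> cabv. vint \<mu> f \<in> - cball 0 a}"
      unfolding F_def by blast
    then show "openin weak_star S"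
      using openin_weak_star_basic[of f "- cball 0 a"] by (simp only: open_Compl closed_cball)
  qed
  finally show "openin weak_star (topspace weak_star - (cabv_ball a :: ('t set \<Rightarrow> 'k ^ 'n) set))" .
qed

text \<open>
  Compactness makes each continuous \<open>f\<close> bounded, so its integrals converge by
  \<open>\<bar>\<integral> f d(\<mu> - \<nu> k)\<bar> \<le> \<parallel>f\<parallel>\<^sub>\<infinity> \<parallel>\<mu> - \<nu> k\<parallel>\<close>; thus the sequence converges in the weak* topology.
\<close>

lemma variation_limit_in_weak_star_closed:
  fixes \<nu> :: "nat \<Rightarrow> 't::metric_space set \<Rightarrow> 'k::real_or_complex ^ 'n"
  assumes T: "compact (UNIV :: 't set)" and A: "closedin weak_star A" and \<nu>: "\<And>k. \<nu> k \<in> A" and \<mu>: "\<mu> \<in> cabv"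
    and lim: "\<And>e. e > 0 \<Longrightarrow> \<exists>N. \<forall>k\<ge>N. variation (\<mu> - \<nu> k) \<le> ennreal e"
  shows "\<mu> \<in> A"
proof -
  have Ac: "A \<subseteq> cabv" using closedin_subset[OF A] by simp
  then have \<nu>c: "\<nu> k \<in> cabv" for k using \<nu> by blast
  have conv: "(\<lambda>k. vint (\<nu> k) f) \<longlonglongrightarrow> vint \<mu> f" if f: "continuous_on UNIV f" for f
  proof (rule LIMSEQ_I)
    fix e :: real assume e: "e > 0"
    have "bounded (range f)"
      using compact_imp_bounded[OF compact_continuous_image[OF f T]] .
    then have bb: "bounded_borel f"
      using borel_measurable_continuous_onI[OF f] by (simp add: bounded_borel_def)
    then obtain c where c: "f \<in> borel_measurable borel" "\<And>x. norm (f x) \<le> c" "c \<ge> 0"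
      by (elim bounded_borelE) blast
    define \<epsilon> where "\<epsilon> = e / (c + 1)"
    have \<epsilon>: "\<epsilon> > 0" using e c(3) by (simp add: \<epsilon>_def)
    from lim[OF this] obtain N where N: "\<And>k. k \<ge> N \<Longrightarrow> variation (\<mu> - \<nu> k) \<le> ennreal \<epsilon>" by blast
    have "norm (vint (\<nu> k) f - vint \<mu> f) < e" if "k \<ge> N" for k
    proof -
      have "norm (vint (\<nu> k) f - vint \<mu> f) = norm (vint (\<mu> - \<nu> k) f)"
        by (simp add: vint_diff_measure[OF \<mu> \<nu>c bb] norm_minus_commute)
      also have "\<dots> \<le> c * \<epsilon>"
        using norm_vint_le_variation[OF cabv_diff[OF \<mu> \<nu>c] c N[OF that]] \<epsilon> by simp
      also have "\<dots> < e" using e c(3) by (simp add: \<epsilon>_def field_simps)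
      finally show ?thesis .
    qed
    then show "\<exists>N. \<forall>k\<ge>N. norm (vint (\<nu> k) f - vint \<mu> f) < e" by blast
  qed
  have "\<forall>\<^sub>F k in sequentially. \<nu> k \<in> U" if "openin weak_star U" "\<mu> \<in> U" for U
  proof -
    have "generate_topology_on {{\<mu> \<in> cabv. vint \<mu> f \<in> U} | f U. continuous_on UNIV f \<and> open U} U"
      using that(1) unfolding weak_star_def openin_topology_generated_by_iff .
    then show ?thesis using that(2)
    proof induction
      case (Int a b)
      then show ?case by (simp add: eventually_conj_iff)
    next
      case (UN K)
      then obtain k where "k \<in> K" "\<mu> \<in> k" by blast
      then have "\<forall>\<^sub>F i in sequentially. \<nu> i \<in> k" using UN.IH by blast
      then show ?case by eventually_elim (use \<open>k \<in> K\<close> in blast)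
    next
      case (Basis s)
      then obtain f U where s: "s = {\<mu> \<in> cabv. vint \<mu> f \<in> U}" "continuous_on UNIV f" "open U" by blast
      then have "\<forall>\<^sub>F k in sequentially. vint (\<nu> k) f \<in> U"
        using conv[OF s(2)] Basis.prems by (auto elim: topological_tendstoD)
      then show ?case using \<nu>c by (simp add: s(1))
    qed simp
  qed
  then have "limitin weak_star \<nu> \<mu> sequentially"
    using \<mu> by (simp add: limitin_def)
  then show ?thesis
    by (rule limitin_closedin[OF _ A]) (use \<nu> in auto)
qed

section \<open>Completeness for the variation norm\<close>

lemma norm_le_of_variation_le:
  assumes "\<mu> \<in> cabv" "variation \<mu> \<le> ennreal e" "0 \<le> e"
  shows "norm (\<mu> B) \<le> e"
proof (cases "B \<in> sets borel")
  case True
  have "ennreal (norm (\<mu> B)) \<le> var_on \<mu> B"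
    by (rule norm_le_var_on[where \<mu> = \<mu>, OF cabv_empty[OF assms(1)] True])
  also have "\<dots> \<le> variation \<mu>"
    unfolding variation_eq_var_on by (rule var_on_mono[where \<mu> = \<mu>, OF cabv_empty[OF assms(1)]]) auto
  finally show ?thesis using assms(2,3) by (metis ennreal_le_iff order_trans)
qed (simp add: cabv_nonborel[OF assms(1)] assms(3))

text \<open>
  The sequence converges uniformly on all sets at once. Finite additivity passes to the limit
  pointwise, and uniformity upgrades it to countable additivity. The variation bound passes to the
  limit for each finite partition separately.
\<close>

lemma cabv_complete:
  fixes \<nu> :: "nat \<Rightarrow> 't::topological_space set \<Rightarrow> 'b::banach"
  assumes \<nu>: "\<And>k. \<nu> k \<in> cabv"
    and cauchy: "\<And>e. e > 0 \<Longrightarrow> \<exists>N. \<forall>m\<ge>N. \<forall>n\<ge>N. variation (\<nu> m - \<nu> n) \<le> ennreal e"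
  obtains \<mu> where "\<mu> \<in> cabv" "\<And>B. (\<lambda>k. \<nu> k B) \<longlonglongrightarrow> \<mu> B"
    "\<And>e. e > 0 \<Longrightarrow> \<exists>N. \<forall>k\<ge>N. variation (\<mu> - \<nu> k) \<le> ennreal e"
proof -
  have "Cauchy (\<lambda>k. \<nu> k B)" for B
  proof (rule CauchyI)
    fix e :: real assume e: "e > 0"
    then obtain N where N: "\<And>m n. m \<ge> N \<Longrightarrow> n \<ge> N \<Longrightarrow> variation (\<nu> m - \<nu> n) \<le> ennreal (e / 2)"
      using cauchy[of "e / 2"] by auto
    have "norm (\<nu> m B - \<nu> n B) < e" if "m \<ge> N" "n \<ge> N" for m n
      using norm_le_of_variation_le[OF cabv_diff[OF \<nu> \<nu>] N[OF that], of B] e by simp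
    then show "\<exists>N. \<forall>m\<ge>N. \<forall>n\<ge>N. norm (\<nu> m B - \<nu> n B) < e" by blast
  qed
  then have "\<exists>L. (\<lambda>k. \<nu> k B) \<longlonglongrightarrow> L" for B
    by (simp add: Cauchy_convergent_iff convergent_def)
  then obtain \<mu> where lim: "\<And>B. (\<lambda>k. \<nu> k B) \<longlonglongrightarrow> \<mu> B" by metis
  have var: "\<exists>N. \<forall>k\<ge>N. variation (\<mu> - \<nu> k) \<le> ennreal e" if e: "e > 0" for e
  proof -
    obtain N where N: "\<And>m n. m \<ge> N \<Longrightarrow> n \<ge> N \<Longrightarrow> variation (\<nu> m - \<nu> n) \<le> ennreal e"
      using cauchy[OF e] by auto
    have "variation (\<mu> - \<nu> k) \<le> ennreal e" if k: "k \<ge> N" for k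
      unfolding variation_def[of "\<mu> - \<nu> k"]
    proof (rule SUP_least)
      fix P :: "'t set set" assume P: "P \<in> {P. finite P \<and> partition_on UNIV P \<and> P \<subseteq> sets borel}"
      have "(\<Sum>A\<in>P. norm ((\<mu> - \<nu> k) A)) \<le> e"
      proof (rule tendsto_upperbound)
        show "(\<lambda>m. \<Sum>A\<in>P. norm ((\<nu> m - \<nu> k) A)) \<longlonglongrightarrow> (\<Sum>A\<in>P. norm ((\<mu> - \<nu> k) A))"
          unfolding fun_diff_def by (intro tendsto_intros lim)
        have "(\<Sum>A\<in>P. norm ((\<nu> m - \<nu> k) A)) \<le> e" if "m \<ge> N" for m
        proof -
          have "ennreal (\<Sum>A\<in>P. norm ((\<nu> m - \<nu> k) A)) = (\<Sum>A\<in>P. ennreal (norm ((\<nu> m - \<nu> k) A)))"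
            by (rule sum_ennreal[symmetric]) simp
          also have "\<dots> \<le> variation (\<nu> m - \<nu> k)"
            unfolding variation_def by (rule SUP_upper[OF P])
          also have "\<dots> \<le> ennreal e" by (rule N[OF that k])
          finally show ?thesis using e by (simp only: ennreal_le_iff less_imp_le)
        qed
        then show "\<forall>\<^sub>F m in sequentially. (\<Sum>A\<in>P. norm ((\<nu> m - \<nu> k) A)) \<le> e"
          unfolding eventually_sequentially by blast
      qed simp
      then show "(\<Sum>A\<in>P. ennreal (norm ((\<mu> - \<nu> k) A))) \<le> ennreal e"
        using e by (simp only: sum_ennreal norm_ge_zero ennreal_leI)
    qed
    then show ?thesis by blast
  qed
  have unif: "\<exists>k. \<forall>B. norm (\<mu> B - \<nu> k B) \<le> e" if e: "e > 0" for e
  proof -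
    obtain N where N: "\<And>m n. m \<ge> N \<Longrightarrow> n \<ge> N \<Longrightarrow> variation (\<nu> m - \<nu> n) \<le> ennreal e"
      using cauchy[OF e] by auto
    have "norm (\<mu> B - \<nu> N B) \<le> e" for B
    proof (rule tendsto_upperbound)
      show "(\<lambda>m. norm (\<nu> m B - \<nu> N B)) \<longlonglongrightarrow> norm (\<mu> B - \<nu> N B)"
        by (intro tendsto_intros lim)
      have "norm (\<nu> m B - \<nu> N B) \<le> e" if "m \<ge> N" for m
        using norm_le_of_variation_le[OF cabv_diff[OF \<nu> \<nu>] N[OF that order_refl], of B] e by simp
      then show "\<forall>\<^sub>F m in sequentially. norm (\<nu> m B - \<nu> N B) \<le> e"
        unfolding eventually_sequentially by blast
    qed simp
    then show ?thesis by blast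
  qed
  have "\<mu> \<in> cabv"
    unfolding cabv_def mem_Collect_eq
  proof (intro conjI allI impI)
    fix B :: "'t set" assume "B \<notin> sets borel"
    then show "\<mu> B = 0"
      using lim[of B] cabv_nonborel[OF \<nu>] by (simp add: LIMSEQ_const_iff)
  next
    obtain N where "variation (\<mu> - \<nu> N) \<le> ennreal 1" using var[of 1] by auto
    then have "variation (\<mu> - \<nu> N) + variation (\<nu> N) < \<infinity>"
      using cabv_variation[OF \<nu>, of N] by (auto intro: le_less_trans)
    then show "variation \<mu> < \<infinity>"
      using variation_add_le[of "\<mu> - \<nu> N" "\<nu> N"] by (simp add: le_less_trans)
  next
    fix A :: "nat \<Rightarrow> 't set" assume A: "range A \<subseteq> sets borel" "disjoint_family A"
    have fin: "(\<Sum>i<n. \<rho> (A i)) = \<rho> (\<Union>i<n. A i)" if "\<rho> \<in> cabv" for \<rho> :: "'t set \<Rightarrow> 'b" and n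
      using A by (intro cabv_finite_UN[OF that, symmetric]) (auto intro: disjoint_family_on_mono)
    have fin\<mu>: "(\<Sum>i<n. \<mu> (A i)) = \<mu> (\<Union>i<n. A i)" for n
    proof (rule LIMSEQ_unique)
      show "(\<lambda>k. \<Sum>i<n. \<nu> k (A i)) \<longlonglongrightarrow> (\<Sum>i<n. \<mu> (A i))" by (intro tendsto_intros lim)
      show "(\<lambda>k. \<Sum>i<n. \<nu> k (A i)) \<longlonglongrightarrow> \<mu> (\<Union>i<n. A i)" unfolding fin[OF \<nu>] by (rule lim)
    qed
    show "(\<lambda>i. \<mu> (A i)) sums \<mu> (\<Union>i. A i)"
      unfolding sums_def fin\<mu>
    proof (rule LIMSEQ_I)
      fix e :: real assume e: "e > 0"
      obtain k where k: "\<And>B. norm (\<mu> B - \<nu> k B) \<le> e / 4"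
        using unif[of "e / 4"] e by auto
      have k3: "dist (\<mu> B) (\<nu> k B) < e / 3" for B
        using k[of B] e by (simp add: dist_norm)
      have "(\<lambda>n. \<nu> k (\<Union>i<n. A i)) \<longlonglongrightarrow> \<nu> k (\<Union>i. A i)"
        using cabv_sums[OF \<nu> A, of k] unfolding sums_def fin[OF \<nu>] .
      then obtain N where N: "\<And>n. n \<ge> N \<Longrightarrow> dist (\<nu> k (\<Union>i<n. A i)) (\<nu> k (\<Union>i. A i)) < e / 3"
        using e by (metis lim_sequentially divide_pos_pos zero_less_numeral)
      have "norm (\<mu> (\<Union>i<n. A i) - \<mu> (\<Union>i. A i)) < e" if "n \<ge> N" for n
        using dist_triangle_third[OF k3 N[OF that] k3[unfolded dist_commute[of "\<mu> _"]]] by (simp add: dist_norm)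
      then show "\<exists>N. \<forall>n\<ge>N. norm (\<mu> (\<Union>i<n. A i) - \<mu> (\<Union>i. A i)) < e" by blast
    qed
  qed
  then show ?thesis using lim var by (rule that)
qed

section \<open>The operator H\<close>

lemma op_image_diff:
  "bounded_linear R \<Longrightarrow> op_image R h (\<mu> - \<nu>) = op_image R h \<mu> - op_image R h \<nu>"
  by (auto simp: op_image_def fun_eq_iff linear_diff bounded_linear.linear)

lemma sum_apply: "(\<Sum>i\<in>I. f i) x = (\<Sum>i\<in>I. f i x)"
  by (induction I rule: infinite_finite_induct) auto

text \<open>
  The data \<open>\<omega>\<close>, \<open>R\<close> of the operator, over an arbitrary finite index set. The two factors below bound
  \<open>H\<close> in the variation norm and in the Monge-Kantorovich norm, respectively.
\<close>

locale lipschitz_operator_system =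
  fixes I :: "'i set"
    and \<omega> :: "'i \<Rightarrow> 't::metric_space \<Rightarrow> 't"
    and R :: "'i \<Rightarrow> 'k::real_or_complex ^ 'n \<Rightarrow> 'k ^ 'n"
  assumes fin: "finite I"
    and Lip: "i \<in> I \<Longrightarrow> \<omega> i \<in> Lip"
    and ops: "i \<in> I \<Longrightarrow> R i \<in> cont_lin_ops"
begin

definition H :: "('t set \<Rightarrow> 'k ^ 'n) \<Rightarrow> 't set \<Rightarrow> 'k ^ 'n" where
  "H \<mu> = (\<Sum>i\<in>I. op_image (R i) (\<omega> i) \<mu>)"

definition tv_factor :: real where
  "tv_factor = (\<Sum>i\<in>I. onorm (R i))"

definition mk_factor :: real where
  "mk_factor = (\<Sum>i\<in>I. onorm (R i) * (1 + enn2real (lip (\<omega> i))))"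

lemma bounded_linear_R: "i \<in> I \<Longrightarrow> bounded_linear (R i)"
  by (rule cont_lin_ops_bounded_linear[OF ops])

lemma onorm_nonneg: "i \<in> I \<Longrightarrow> 0 \<le> onorm (R i)"
  by (rule onorm_pos_le[OF bounded_linear_R])

lemma \<omega>_measurable: "i \<in> I \<Longrightarrow> \<omega> i \<in> borel_measurable borel"
  by (rule Lip_imp_borel_measurable[OF Lip])

lemma tv_factor_nonneg: "0 \<le> tv_factor"
  unfolding tv_factor_def by (intro sum_nonneg onorm_nonneg)

lemma tv_factor_le_mk_factor: "tv_factor \<le> mk_factor"
  unfolding tv_factor_def mk_factor_def
  by (intro sum_mono) (simp add: mult_le_cancel_left1 onorm_nonneg algebra_simps)

lemma op_image_cabv: "\<mu> \<in> cabv \<Longrightarrow> i \<in> I \<Longrightarrow> op_image (R i) (\<omega> i) \<mu> \<in> cabv"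
  by (intro cabv_op_image bounded_linear_R \<omega>_measurable)

lemma H_diff: "H (\<mu> - \<nu>) = H \<mu> - H \<nu>"
  by (simp add: H_def op_image_diff[OF bounded_linear_R] sum_subtractf)

lemma H_cabv_variation:
  assumes \<mu>: "\<mu> \<in> cabv"
  shows "H \<mu> \<in> cabv \<and> variation (H \<mu>) \<le> ennreal tv_factor * variation \<mu>"
proof -
  have "(\<Sum>i\<in>J. op_image (R i) (\<omega> i) \<mu>) \<in> cabv \<and>
      variation (\<Sum>i\<in>J. op_image (R i) (\<omega> i) \<mu>) \<le> ennreal (\<Sum>i\<in>J. onorm (R i)) * variation \<mu>"
    if "J \<subseteq> I" for J
    using finite_subset[OF that fin] that
  proof (induction J)
    case empty
    have "variation (0 :: 't set \<Rightarrow> 'k ^ 'n) = 0"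
      using variation_op_image_le[OF cabv_0 bounded_linear_zero, of id] by (simp add: onorm_zero op_image_def zero_fun_def)
    then show ?case using cabv_0 by (simp only: sum.empty ennreal_0 mult_zero_left order_refl simp_thms)
  next
    case (insert i J)
    let ?\<nu> = "\<Sum>i\<in>J. op_image (R i) (\<omega> i) \<mu>"
    have i: "i \<in> I" and IH: "?\<nu> \<in> cabv" "variation ?\<nu> \<le> ennreal (\<Sum>i\<in>J. onorm (R i)) * variation \<mu>"
      using insert by auto
    have "variation (op_image (R i) (\<omega> i) \<mu> + ?\<nu>) \<le> variation (op_image (R i) (\<omega> i) \<mu>) + variation ?\<nu>"
      by (rule variation_add_le)
    also have "\<dots> \<le> ennreal (onorm (R i)) * variation \<mu> + ennreal (\<Sum>i\<in>J. onorm (R i)) * variation \<mu>"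
      using i IH(2) by (intro add_mono variation_op_image_le \<mu> bounded_linear_R \<omega>_measurable)
    also have "\<dots> = (ennreal (onorm (R i)) + ennreal (\<Sum>i\<in>J. onorm (R i))) * variation \<mu>"
      by (rule distrib_right[symmetric])
    also have "\<dots> = ennreal (onorm (R i) + (\<Sum>i\<in>J. onorm (R i))) * variation \<mu>"
      using insert.prems i by (subst ennreal_plus) (auto intro!: sum_nonneg onorm_nonneg)
    finally show ?case
      unfolding sum.insert[OF insert.hyps] using cabv_add[OF op_image_cabv[OF \<mu> i] IH(1)] by blast
  qed
  then show ?thesis by (simp add: H_def tv_factor_def)
qed

lemma H_cabv: "\<mu> \<in> cabv \<Longrightarrow> H \<mu> \<in> cabv"
  using H_cabv_variation by blast

lemma vint_H:
  assumes \<mu>: "\<mu> \<in> cabv" and f: "bounded_borel f"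
  shows "vint (H \<mu>) f = (\<Sum>i\<in>I. vint \<mu> (\<lambda>x. adj_op (R i) (f (\<omega> i x))))"
proof -
  have "(\<Sum>i\<in>J. op_image (R i) (\<omega> i) \<mu>) \<in> cabv \<and>
     vint (\<Sum>i\<in>J. op_image (R i) (\<omega> i) \<mu>) f = (\<Sum>i\<in>J. vint (op_image (R i) (\<omega> i) \<mu>) f)"
    if "J \<subseteq> I" for J
    using finite_subset[OF that fin] that
  proof (induction J)
    case empty
    show ?case using vint_diff_measure[OF cabv_0 cabv_0 f] cabv_0 by (simp only: sum.empty diff_self simp_thms)
  next
    case (insert i J)
    then have i: "op_image (R i) (\<omega> i) \<mu> \<in> cabv"
      and IH: "(\<Sum>i\<in>J. op_image (R i) (\<omega> i) \<mu>) \<in> cabv"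
        "vint (\<Sum>i\<in>J. op_image (R i) (\<omega> i) \<mu>) f = (\<Sum>i\<in>J. vint (op_image (R i) (\<omega> i) \<mu>) f)"
      by (blast intro: op_image_cabv[OF \<mu>])+
    show ?case
      unfolding sum.insert[OF insert.hyps] vint_add_measure[OF i IH(1) f] IH(2)
      using cabv_add[OF i IH(1)] by blast
  qed
  then have "vint (H \<mu>) f = (\<Sum>i\<in>I. vint (op_image (R i) (\<omega> i) \<mu>) f)"
    by (simp add: H_def)
  also have "\<dots> = (\<Sum>i\<in>I. vint \<mu> (\<lambda>x. adj_op (R i) (f (\<omega> i x))))"
    by (intro sum.cong refl vint_op_image \<mu> ops \<omega>_measurable f)
  finally show ?thesis .
qed

lemma bl_bound_adj_op_comp:
  assumes i: "i \<in> I" and f: "bl_bound s l f"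
  shows "bl_bound (onorm (R i) * s) (onorm (R i) * (l * enn2real (lip (\<omega> i)))) (\<lambda>x. adj_op (R i) (f (\<omega> i x)))"
proof -
  have l: "0 \<le> l" using f by (simp add: bl_bound_def)
  have "norm (adj_op (R i) (f (\<omega> i x))) \<le> onorm (R i) * s" for x
    using f order_trans[OF norm_adj_op_le[OF ops[OF i]] mult_left_mono[OF _ onorm_nonneg[OF i]]]
    by (simp add: bl_bound_def)
  moreover have "dist (adj_op (R i) (f (\<omega> i x))) (adj_op (R i) (f (\<omega> i y)))
      \<le> onorm (R i) * (l * enn2real (lip (\<omega> i))) * dist x y" for x y
  proof -
    have "dist (adj_op (R i) (f (\<omega> i x))) (adj_op (R i) (f (\<omega> i y))) = norm (adj_op (R i) (f (\<omega> i x) - f (\<omega> i y)))"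
      by (simp add: dist_norm linear_diff[OF bounded_linear.linear[OF bounded_linear_adj_op[OF ops[OF i]]]])
    also have "\<dots> \<le> onorm (R i) * dist (f (\<omega> i x)) (f (\<omega> i y))"
      unfolding dist_norm by (rule norm_adj_op_le[OF ops[OF i]])
    also have "\<dots> \<le> onorm (R i) * (l * dist (\<omega> i x) (\<omega> i y))"
      using f by (intro mult_left_mono onorm_nonneg[OF i]) (simp add: bl_bound_def)
    also have "\<dots> \<le> onorm (R i) * (l * (enn2real (lip (\<omega> i)) * dist x y))"
      using l by (intro mult_left_mono onorm_nonneg[OF i] Lip_dist_le[OF Lip[OF i]])
    finally show ?thesis by (simp add: mult_ac)
  qed
  ultimately show ?thesis
    using f onorm_nonneg[OF i] by (simp add: bl_bound_def)
qed

lemma mk_norm_H_le: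
  assumes \<mu>: "\<mu> \<in> cabv"
  shows "mk_norm (H \<mu>) \<le> mk_factor * mk_norm \<mu>"
proof (rule mk_norm_le)
  fix f :: "'t \<Rightarrow> 'k ^ 'n" and s l assume f: "bl_bound s l f" "s + l \<le> 1"
  have sl: "0 \<le> s" "s \<le> 1" "0 \<le> l" "l \<le> 1" using f by (auto simp: bl_bound_def)
  have "norm (vint (H \<mu>) f) \<le> (\<Sum>i\<in>I. norm (vint \<mu> (\<lambda>x. adj_op (R i) (f (\<omega> i x)))))"
    unfolding vint_H[OF \<mu> bl_bound_bounded_borel[OF f(1)]] by (rule norm_sum)
  also have "\<dots> \<le> (\<Sum>i\<in>I. (onorm (R i) * (1 + enn2real (lip (\<omega> i)))) * mk_norm \<mu>)"
  proof (rule sum_mono)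
    fix i assume i: "i \<in> I"
    have "norm (vint \<mu> (\<lambda>x. adj_op (R i) (f (\<omega> i x))))
      \<le> (onorm (R i) * s + onorm (R i) * (l * enn2real (lip (\<omega> i)))) * mk_norm \<mu>"
      by (rule norm_vint_le_mk_norm[OF \<mu> bl_bound_adj_op_comp[OF i f(1)]])
    also have "\<dots> \<le> (onorm (R i) * (1 + enn2real (lip (\<omega> i)))) * mk_norm \<mu>"
    proof (rule mult_right_mono[OF _ mk_norm_nonneg[OF \<mu>]])
      have "s + l * enn2real (lip (\<omega> i)) \<le> 1 + 1 * enn2real (lip (\<omega> i))"
        using sl by (intro add_mono mult_right_mono) auto
      then show "onorm (R i) * s + onorm (R i) * (l * enn2real (lip (\<omega> i))) \<le> onorm (R i) * (1 + enn2real (lip (\<omega> i)))"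
        unfolding distrib_left[symmetric] by (intro mult_left_mono onorm_nonneg[OF i]) simp
    qed
    finally show "norm (vint \<mu> (\<lambda>x. adj_op (R i) (f (\<omega> i x)))) \<le> (onorm (R i) * (1 + enn2real (lip (\<omega> i)))) * mk_norm \<mu>" .
  qed
  also have "\<dots> = mk_factor * mk_norm \<mu>" by (simp add: mk_factor_def sum_distrib_right)
  finally show "norm (vint (H \<mu>) f) \<le> mk_factor * mk_norm \<mu>" .
qed

text \<open>
  A fixed point satisfies \<open>\<parallel>\<mu>\<parallel> \<le> c \<parallel>\<mu>\<parallel>\<close> with \<open>c < 1\<close> and finite \<open>\<parallel>\<mu>\<parallel>\<close>. By linearity, this covers
  uniqueness of the fixed points of \<open>\<mu> \<mapsto> H \<mu> + \<mu>0\<close> as well.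
\<close>

lemma H_fixed_imp_0:
  assumes c: "tv_factor < 1" and \<mu>: "\<mu> \<in> cabv" "H \<mu> = \<mu>"
  shows "\<mu> = 0"
proof
  fix B
  define v where "v = enn2real (variation \<mu>)"
  have v: "variation \<mu> = ennreal v" "0 \<le> v"
    using cabv_variation[OF \<mu>(1)] by (simp_all add: v_def)
  have "ennreal v \<le> ennreal (tv_factor * v)"
    using H_cabv_variation[OF \<mu>(1)] \<mu>(2) v tv_factor_nonneg by (simp add: ennreal_mult)
  then have "v \<le> tv_factor * v" using v(2) tv_factor_nonneg by simp
  then have "(1 - tv_factor) * v \<le> 0" by (simp add: algebra_simps)
  then have "v = 0" using c v(2) by (simp add: mult_le_0_iff)
  then show "\<mu> B = 0 B"
    using norm_le_of_variation_le[OF \<mu>(1), of 0 B] v(1) by simp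
qed

lemma H_tendsto:
  assumes "\<And>B. (\<lambda>k. \<nu> k B) \<longlonglongrightarrow> \<mu> B"
  shows "(\<lambda>k. H (\<nu> k) B) \<longlonglongrightarrow> H \<mu> B"
proof -
  have "(\<lambda>k. op_image (R i) (\<omega> i) (\<nu> k) B) \<longlonglongrightarrow> op_image (R i) (\<omega> i) \<mu> B" if "i \<in> I" for i
    using bounded_linear.tendsto[OF bounded_linear_R[OF that] assms] by (simp add: op_image_def)
  then show ?thesis
    unfolding H_def sum_apply by (intro tendsto_sum)
qed

text \<open>
  Banach's iteration in the variation norm. Because all iterates lie in a ball of radius \<open>a\<close>, the
  distance of any two of them is at most \<open>2 a\<close>, and applying the map \<open>n\<close> times shrinks it by the
  factor \<open>c\<^sup>n\<close>. The fixed point equation follows from convergence on each Borel set.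
\<close>

lemma affine_fixed_point:
  assumes T: "compact (UNIV :: 't set)" and c: "tv_factor < 1"
    and A: "A \<noteq> {}" "A \<subseteq> cabv_ball a" "closedin weak_star A" and a: "0 \<le> a"
    and inv: "\<And>\<mu>. \<mu> \<in> A \<Longrightarrow> H \<mu> + \<mu>0 \<in> A"
  shows "\<exists>\<mu>\<in>A. H \<mu> + \<mu>0 = \<mu>"
proof -
  define G where "G \<mu> = H \<mu> + \<mu>0" for \<mu>
  obtain \<mu>1 where \<mu>1: "\<mu>1 \<in> A" using A(1) by blast
  define \<nu> where "\<nu> k = (G ^^ k) \<mu>1" for k
  have \<nu>A: "\<nu> k \<in> A" for k
    unfolding \<nu>_def by (induction k) (simp_all only: funpow.simps o_apply id_apply \<mu>1 G_def inv)
  have \<nu>c: "\<nu> k \<in> cabv" and \<nu>a: "variation (\<nu> k) \<le> ennreal a" for k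
    using \<nu>A A(2) by (auto simp: cabv_ball_def)
  have step: "\<nu> (Suc m) - \<nu> (Suc n) = H (\<nu> m - \<nu> n)" for m n
    by (simp add: \<nu>_def G_def H_diff)
  have le: "variation (\<nu> (n + j) - \<nu> n) \<le> ennreal (tv_factor ^ n * (2 * a))"
    and le': "variation (\<nu> n - \<nu> (n + j)) \<le> ennreal (tv_factor ^ n * (2 * a))" for n j
  proof -
    have bound: "variation (\<nu> k - \<nu> m) \<le> ennreal (2 * a)" for k m
      using order_trans[OF variation_diff_le add_mono[OF \<nu>a \<nu>a], of k m] a by (simp flip: ennreal_plus)
    show *: "variation (\<nu> (n + j) - \<nu> n) \<le> ennreal (tv_factor ^ n * (2 * a))"
    proof (induction n)
      case 0
      show ?case using bound[of "0 + j" 0] by (simp only: power_0 mult_1)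
    next
      case (Suc n)
      have "variation (\<nu> (Suc n + j) - \<nu> (Suc n)) = variation (H (\<nu> (n + j) - \<nu> n))"
        using step[of "n + j" n] by simp
      also have "\<dots> \<le> ennreal tv_factor * variation (\<nu> (n + j) - \<nu> n)"
        using H_cabv_variation[OF cabv_diff[OF \<nu>c \<nu>c]] by blast
      also have "\<dots> \<le> ennreal tv_factor * ennreal (tv_factor ^ n * (2 * a))"
        by (rule mult_left_mono[OF Suc.IH]) simp
      also have "\<dots> = ennreal (tv_factor ^ Suc n * (2 * a))"
        using tv_factor_nonneg a by (simp add: mult.assoc flip: ennreal_mult)
      finally show ?case .
    qed
    show "variation (\<nu> n - \<nu> (n + j)) \<le> ennreal (tv_factor ^ n * (2 * a))"
      using * variation_uminus[of "\<nu> n - \<nu> (n + j)"] by simp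
  qed
  have cauchy: "\<exists>N. \<forall>m\<ge>N. \<forall>n\<ge>N. variation (\<nu> m - \<nu> n) \<le> ennreal e" if e: "e > 0" for e
  proof -
    have "(\<lambda>n. tv_factor ^ n * (2 * a)) \<longlonglongrightarrow> 0 * (2 * a)"
      using tv_factor_nonneg c by (intro tendsto_intros LIMSEQ_power_zero) simp
    then have "\<forall>\<^sub>F n in sequentially. tv_factor ^ n * (2 * a) < e"
      using e by (intro order_tendstoD(2)) auto
    then obtain N where N: "\<And>n. n \<ge> N \<Longrightarrow> tv_factor ^ n * (2 * a) < e"
      by (auto simp: eventually_sequentially)
    have "variation (\<nu> m - \<nu> n) \<le> ennreal e" if "m \<ge> N" "n \<ge> N" for m n
    proof (cases "n \<le> m")
      case True
      then show ?thesis
        using le[of n "m - n"] ennreal_leI[OF less_imp_le[OF N[OF that(2)]]] by (auto intro: order_trans)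
    next
      case False
      then show ?thesis
        using le'[of m "n - m"] ennreal_leI[OF less_imp_le[OF N[OF that(1)]]] by (auto intro: order_trans)
    qed
    then show ?thesis by blast
  qed
  obtain \<mu> where \<mu>: "\<mu> \<in> cabv" and lim: "\<And>B. (\<lambda>k. \<nu> k B) \<longlonglongrightarrow> \<mu> B"
    and var: "\<And>e. e > 0 \<Longrightarrow> \<exists>N. \<forall>k\<ge>N. variation (\<mu> - \<nu> k) \<le> ennreal e"
    using cabv_complete[OF \<nu>c cauchy] by blast
  have "\<mu> \<in> A"
    by (rule variation_limit_in_weak_star_closed[OF T A(3) \<nu>A \<mu> var])
  moreover have "H \<mu> + \<mu>0 = \<mu>"
  proof
    fix B
    have "(\<lambda>k. H (\<nu> k) B + \<mu>0 B) \<longlonglongrightarrow> H \<mu> B + \<mu>0 B"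
      by (intro tendsto_intros H_tendsto lim)
    moreover have "(\<lambda>k. H (\<nu> k) B + \<mu>0 B) = (\<lambda>k. \<nu> (Suc k) B)"
      by (simp add: \<nu>_def G_def)
    ultimately show "(H \<mu> + \<mu>0) B = \<mu> B"
      using LIMSEQ_unique LIMSEQ_Suc[OF lim[of B]] by fastforce
  qed
  ultimately show ?thesis by blast
qed

text \<open>
  Strictness comes from \<open>r i < 1\<close> for an index with \<open>R i \<noteq> 0\<close>; if no such index exists, the factor is
  \<open>0\<close>.
\<close>

lemma mk_factor_less_1_of_contractions:
  assumes "\<And>i. i \<in> I \<Longrightarrow> contraction_on UNIV dist (\<omega> i)" and half: "tv_factor \<le> 1 / 2"
  shows "mk_factor < 1"
proof -
  have r: "enn2real (lip (\<omega> i)) < 1" if "i \<in> I" for i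
  proof -
    have "lip (\<omega> i) < ennreal 1" using assms(1)[OF that] by (simp add: contraction_on_def)
    then show ?thesis by (cases "lip (\<omega> i)") (simp_all add: ennreal_less_iff)
  qed
  show ?thesis
  proof (cases "\<exists>i\<in>I. onorm (R i) > 0")
    case True
    have "mk_factor < (\<Sum>i\<in>I. onorm (R i) * 2)"
      unfolding mk_factor_def
    proof (rule sum_strict_mono_ex1[OF fin])
      show "\<forall>i\<in>I. onorm (R i) * (1 + enn2real (lip (\<omega> i))) \<le> onorm (R i) * 2"
        using less_imp_le[OF r] by (intro ballI mult_left_mono onorm_nonneg) simp_all
      show "\<exists>i\<in>I. onorm (R i) * (1 + enn2real (lip (\<omega> i))) < onorm (R i) * 2"
      proof -
        obtain i where "i \<in> I" "onorm (R i) > 0" using True by blast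
        then show ?thesis using r[of i] by (intro bexI[of _ i] mult_strict_left_mono) auto
      qed
    qed
    also have "\<dots> = tv_factor * 2" by (simp add: tv_factor_def sum_distrib_right)
    finally show ?thesis using half by simp
  next
    case False
    then have "onorm (R i) = 0" if "i \<in> I" for i using onorm_nonneg[OF that] that by force
    then show ?thesis by (simp add: mk_factor_def)
  qed
qed

lemma affine_ball_invariant:
  assumes \<mu>0: "\<mu>0 \<in> cabv" and a: "0 \<le> a" and le: "variation \<mu>0 + ennreal (a * tv_factor) \<le> ennreal a"
    and \<mu>: "\<mu> \<in> cabv_ball a"
  shows "H \<mu> + \<mu>0 \<in> cabv_ball a"
proof -
  have \<mu>c: "\<mu> \<in> cabv" "variation \<mu> \<le> ennreal a" using \<mu> by (auto simp: cabv_ball_def)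
  have "variation (H \<mu> + \<mu>0) \<le> variation (H \<mu>) + variation \<mu>0" by (rule variation_add_le)
  also have "\<dots> \<le> ennreal tv_factor * ennreal a + variation \<mu>0"
    by (intro add_mono order_refl order_trans[OF conjunct2[OF H_cabv_variation[OF \<mu>c(1)]]] mult_left_mono \<mu>c(2)) simp
  also have "\<dots> = variation \<mu>0 + ennreal (a * tv_factor)"
    using a tv_factor_nonneg by (simp add: ennreal_mult mult.commute add.commute)
  finally show ?thesis
    using le \<mu>0 H_cabv[OF \<mu>c(1)] by (auto simp: cabv_ball_def cabv_add)
qed

lemma lip_on_mk_dist_affine_le:
  assumes A: "A \<subseteq> cabv" and \<mu>0: "\<mu>0 \<in> cabv"
  shows "lip_on A mk_dist mk_dist (\<lambda>\<mu>. H \<mu> + \<mu>0) \<le> ennreal mk_factor"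
  unfolding lip_on_def
proof (rule SUP_least, clarify)
  fix \<mu> \<nu> assume \<mu>\<nu>: "\<mu> \<in> A" "\<nu> \<in> A" "\<mu> \<noteq> \<nu>"
  then have c: "\<mu> \<in> cabv" "\<nu> \<in> cabv" using A by auto
  interpret Metric_space A mk_dist by (rule Metric_space_mk_dist[OF A])
  have pos: "mk_dist \<mu> \<nu> > 0" using \<mu>\<nu> by (simp add: mdist_pos_less)
  have "mk_dist (H \<mu> + \<mu>0) (H \<nu> + \<mu>0) = mk_norm (H (\<mu> - \<nu>))"
    using c \<mu>0 by (simp add: mk_dist_def H_cabv cabv_add H_diff)
  also have "\<dots> \<le> mk_factor * mk_dist \<mu> \<nu>"
    using mk_norm_H_le[OF cabv_diff[OF c]] c by (simp add: mk_dist_def)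
  finally show "ennreal (mk_dist (H \<mu> + \<mu>0) (H \<nu> + \<mu>0) / mk_dist \<mu> \<nu>) \<le> ennreal mk_factor"
    using pos by (intro ennreal_leI) (simp add: divide_le_eq)
qed

end

theorem theorem2p2p2:
  fixes \<omega> :: "nat \<Rightarrow> 't::metric_space \<Rightarrow> 't"
    and R :: "nat \<Rightarrow> 'k::real_or_complex ^ 'n \<Rightarrow> 'k ^ 'n"
    and H H2 :: "('t set \<Rightarrow> 'k ^ 'n) \<Rightarrow> ('t set \<Rightarrow> 'k ^ 'n)"
    and \<mu>0 :: "'t set \<Rightarrow> 'k ^ 'n"
    and A :: "('t set \<Rightarrow> 'k ^ 'n) set"
    and r :: "nat \<Rightarrow> real" and a d :: real and M :: nat
  assumes "compact (UNIV :: 't set)"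
    and "\<exists>x y :: 't. x \<noteq> y"
    and "M \<ge> 1"
    and "\<And>i. i \<in> {1..M} \<Longrightarrow> \<omega> i \<in> Lip"
    and "\<And>i. i \<in> {1..M} \<Longrightarrow> r i = enn2real (lip (\<omega> i))"
    and "\<And>i. i \<in> {1..M} \<Longrightarrow> R i \<in> cont_lin_ops"
    and "H = (\<lambda>\<mu>. \<Sum>i=1..M. op_image (R i) (\<omega> i) \<mu>)"
    and "d = (\<Sum>i=1..M. onorm (R i) * (1 + r i))"
    and "0 < a"
    and "\<mu>0 \<in> cabv"
    and "H2 = (\<lambda>\<mu>. H \<mu> + \<mu>0)"
  shows "H \<in> cabv \<rightarrow> cabv
    \<and> ((\<forall>i\<in>{1..M}. contraction_on UNIV dist (\<omega> i)) \<and> (\<Sum>i=1..M. onorm (R i)) \<le> 1/2 \<longrightarrow> d < 1)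
    \<and> (variation \<mu>0 + ennreal (a * (\<Sum>i=1..M. onorm (R i))) \<le> ennreal a \<longrightarrow>
         cabv_ball a \<noteq> ({} :: ('t set \<Rightarrow> 'k ^ 'n) set)
         \<and> closedin weak_star (cabv_ball a :: ('t set \<Rightarrow> 'k ^ 'n) set)
         \<and> (\<forall>\<mu>\<in>cabv_ball a. H \<mu> + \<mu>0 \<in> cabv_ball a))
    \<and> (d < 1 \<and> A \<noteq> {} \<and> A \<subseteq> cabv_ball a \<and> closedin weak_star A \<and> (\<forall>\<mu>\<in>A. H \<mu> + \<mu>0 \<in> A) \<longrightarrow>
         Metric_space A mk_dist
         \<and> contraction_on A mk_dist H2
         \<and> lip_on A mk_dist mk_dist H2 \<le> ennreal d
         \<and> (\<mu>0 = 0 \<longrightarrow> 0 \<in> A)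
         \<and> (\<exists>\<mu>s\<in>A. H2 \<mu>s = \<mu>s \<and> (\<forall>\<nu>\<in>A. H2 \<nu> = \<nu> \<longrightarrow> \<nu> = \<mu>s) \<and> (\<mu>0 = 0 \<longrightarrow> \<mu>s = 0)))"
proof -
  interpret S: lipschitz_operator_system "{1..M}" \<omega> R
    by unfold_locales (use assms(4,6) in auto)
  have H: "H = S.H"
    unfolding assms(7) by (rule ext) (rule S.H_def[symmetric])
  have d: "d = S.mk_factor"
    unfolding assms(8) S.mk_factor_def by (intro sum.cong refl) (simp only: assms(5))
  have sum: "(\<Sum>i=1..M. onorm (R i)) = S.tv_factor"
    by (rule S.tv_factor_def[symmetric])
  note \<mu>0 = \<open>\<mu>0 \<in> cabv\<close>
  have HC: "H \<in> cabv \<rightarrow> cabv"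
    unfolding H using S.H_cabv by blast
  have half: "d < 1" if "\<forall>i\<in>{1..M}. contraction_on UNIV dist (\<omega> i)" "(\<Sum>i=1..M. onorm (R i)) \<le> 1/2"
    using S.mk_factor_less_1_of_contractions that unfolding d sum by blast
  have ball: "cabv_ball a \<noteq> ({} :: ('t set \<Rightarrow> 'k ^ 'n) set)
         \<and> closedin weak_star (cabv_ball a :: ('t set \<Rightarrow> 'k ^ 'n) set)
         \<and> (\<forall>\<mu>\<in>cabv_ball a. H \<mu> + \<mu>0 \<in> cabv_ball a)"
    if le: "variation \<mu>0 + ennreal (a * (\<Sum>i=1..M. onorm (R i))) \<le> ennreal a"
  proof (intro conjI ballI)
    have "variation \<mu>0 \<le> ennreal a"
      using le by (metis add_increasing2 order_trans le_iff_add)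
    then show "cabv_ball a \<noteq> ({} :: ('t set \<Rightarrow> 'k ^ 'n) set)"
      using \<mu>0 unfolding cabv_ball_def by blast
    show "closedin weak_star (cabv_ball a :: ('t set \<Rightarrow> 'k ^ 'n) set)"
      by (rule closedin_weak_star_cabv_ball[OF \<open>0 < a\<close>])
    show "H \<mu> + \<mu>0 \<in> cabv_ball a" if "\<mu> \<in> cabv_ball a" for \<mu>
      unfolding H by (rule S.affine_ball_invariant[OF \<mu>0 less_imp_le[OF \<open>0 < a\<close>] le[unfolded sum] that])
  qed
  have main: "Metric_space A mk_dist
         \<and> contraction_on A mk_dist H2
         \<and> lip_on A mk_dist mk_dist H2 \<le> ennreal d
         \<and> (\<mu>0 = 0 \<longrightarrow> 0 \<in> A)
         \<and> (\<exists>\<mu>s\<in>A. H2 \<mu>s = \<mu>s \<and> (\<forall>\<nu>\<in>A. H2 \<nu> = \<nu> \<longrightarrow> \<nu> = \<mu>s) \<and> (\<mu>0 = 0 \<longrightarrow> \<mu>s = 0))"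
    if d1: "d < 1" and A: "A \<noteq> {}" "A \<subseteq> cabv_ball a" "closedin weak_star A"
      and inv: "\<forall>\<mu>\<in>A. H \<mu> + \<mu>0 \<in> A"
  proof -
    have H2: "H2 = (\<lambda>\<mu>. S.H \<mu> + \<mu>0)" using assms(11) H by simp
    have Ac: "A \<subseteq> cabv" using A(2) by (auto simp: cabv_ball_def)
    have c: "S.tv_factor < 1" using d1 d S.tv_factor_le_mk_factor by simp
    have lip: "lip_on A mk_dist mk_dist H2 \<le> ennreal d"
      unfolding H2 d by (rule S.lip_on_mk_dist_affine_le[OF Ac \<mu>0])
    also have "\<dots> < 1" using d1 by (simp add: ennreal_less_one_iff)
    finally have contr: "contraction_on A mk_dist H2"
      using inv by (simp add: contraction_on_def H2 H)
    obtain \<mu>s where \<mu>s: "\<mu>s \<in> A" "S.H \<mu>s + \<mu>0 = \<mu>s"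
      using S.affine_fixed_point[OF assms(1) c A less_imp_le[OF \<open>0 < a\<close>]] inv unfolding H by blast
    have uniq: "\<nu> = \<mu>s" if \<nu>: "\<nu> \<in> A" "H2 \<nu> = \<nu>" for \<nu>
    proof -
      have "S.H (\<nu> - \<mu>s) = (S.H \<nu> + \<mu>0) - (S.H \<mu>s + \<mu>0)" unfolding S.H_diff by simp
      also have "\<dots> = \<nu> - \<mu>s" using \<nu>(2) \<mu>s(2) by (simp add: H2)
      finally have "\<nu> - \<mu>s = 0"
        using \<nu>(1) \<mu>s(1) Ac by (intro S.H_fixed_imp_0[OF c cabv_diff]) auto
      then show ?thesis by simp
    qed
    have zero: "\<mu>s = 0" if "\<mu>0 = 0"
      using S.H_fixed_imp_0[OF c, of \<mu>s] \<mu>s Ac that by auto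
    show ?thesis
    proof (intro conjI bexI[of _ \<mu>s])
      show "\<mu>0 = 0 \<longrightarrow> 0 \<in> A"
        using zero \<mu>s(1) by metis
      show "H2 \<mu>s = \<mu>s"
        unfolding H2 by (rule \<mu>s(2))
    qed (use Metric_space_mk_dist[OF Ac] contr lip \<mu>s(1) uniq zero in blast)+
  qed
  show ?thesis
    by (intro conjI impI HC) (use half ball main in blast)+
qed

end
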